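(* For every positive integer $n$, an $n$-qubit Toffoli gate with a relative phase can be implemented, without any ancilla qubits, by a quantum circuit using at most $6n+4$ CNOT gates and having depth $\mathcal{O}(\log n)$. That is, for each $n$ there exist a diagonal unitary $D$ (diagonal in the computational basis of the $n+1$ qubits) and a circuit on exactly $n+1$ qubits ($n$ controls and one target), consisting of single-qubit gates and at most $6n+4$ CNOT gates, of depth $\mathcal{O}(\log n)$, whose unitary is $D\cdot C^nX$.
   Context: Circuits are built from arbitrary single-qubit unitary gates and CNOT gates (between arbitrary pairs of qubits). The CNOT count is the number of CNOT gates used. The depth is the minimal number of layers into which the gates can be arranged so that gates in the same layer act on disjoint qubits. The bound $\mathcal{O}(\log n)$ is with an absolute constant and is understood up to an additive constant, i.e. depth $\le C(1+\log n)$. The $n$-qubit Toffoli gate $C^nX$ has $n$ control qubits and one target qubit: it applies $X=\sigma_x$ to the target if all $n$ controls are in state $|1\rangle$, and acts as the identity on the computational basis states for which some control is $|0\rangle$. An $n$-qubit Toffoli gate with a relative phase is a unitary on the $n+1$ qubits that equals $C^nX$ up to a diagonal gate, i.e. up to multiplication by a unitary diagonal in the computational basis. *)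

theory Defs
  imports Complex_Main "Jordan_Normal_Form.Schur_Decomposition"
begin

(* Operators on N qubits are 2^N x 2^N complex matrices.  The row/column index i stands for the
   computational basis state in which qubit k is |1> iff "bit i k" holds (qubit 0 is the least
   significant bit). *)

definition unitary_mat :: "nat \<Rightarrow> complex mat \<Rightarrow> bool" where
  "unitary_mat d U \<longleftrightarrow> U \<in> carrier_mat d d \<and> mat_adjoint U * U = 1\<^sub>m d \<and> U * mat_adjoint U = 1\<^sub>m d"

(* CNOT c t: control c, target t. *)
datatype gate = Single nat "complex mat" | CNOT nat nat

primrec gate_qubits :: "gate \<Rightarrow> nat set" where
  "gate_qubits (Single q U) = {q}"
| "gate_qubits (CNOT c t) = {c, t}"

primrec valid_gate :: "nat \<Rightarrow> gate \<Rightarrow> bool" where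
  "valid_gate N (Single q U) \<longleftrightarrow> q < N \<and> unitary_mat 2 U"
| "valid_gate N (CNOT c t) \<longleftrightarrow> c < N \<and> t < N \<and> c \<noteq> t"

(* The first equation is the Kronecker product of U, acting on qubit q, with identities on all other
   qubits.  The second is the permutation matrix sending |j> to |j with bit t flipped> if bit c of
   j is set, and to |j> otherwise. *)
primrec gate_mat :: "nat \<Rightarrow> gate \<Rightarrow> complex mat" where
  "gate_mat N (Single q U) = mat (2 ^ N) (2 ^ N) (\<lambda>(i, j).
     if \<forall>k<N. k \<noteq> q \<longrightarrow> bit i k = bit j k
     then U $$ (of_bool (bit i q), of_bool (bit j q)) else 0)"
| "gate_mat N (CNOT c t) = mat (2 ^ N) (2 ^ N) (\<lambda>(i, j).
     of_bool (i = (if bit j c then flip_bit t j else j)))"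

type_synonym circuit = "gate list"

definition valid_circuit :: "nat \<Rightarrow> circuit \<Rightarrow> bool" where
  "valid_circuit N c \<longleftrightarrow> (\<forall>g \<in> set c. valid_gate N g)"

(* The head of the list is applied first. *)
primrec circuit_mat :: "nat \<Rightarrow> circuit \<Rightarrow> complex mat" where
  "circuit_mat N [] = 1\<^sub>m (2 ^ N)"
| "circuit_mat N (g # c) = circuit_mat N c * gate_mat N g"

primrec is_CNOT :: "gate \<Rightarrow> bool" where
  "is_CNOT (Single q U) = False"
| "is_CNOT (CNOT c t) = True"

definition cnot_count :: "circuit \<Rightarrow> nat" where
  "cnot_count c = length (filter is_CNOT c)"

(* L assigns the gate at each position to one of the layers 0, ..., d - 1.  Gates sharing a qubit
   lie in different layers, in the order in which they are applied; so executing the layers one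
   after the other only reorders gates acting on disjoint qubits. *)
definition layering :: "circuit \<Rightarrow> nat \<Rightarrow> (nat \<Rightarrow> nat) \<Rightarrow> bool" where
  "layering c d L \<longleftrightarrow>
     (\<forall>i<length c. L i < d) \<and>
     (\<forall>j<length c. \<forall>i<j. gate_qubits (c ! i) \<inter> gate_qubits (c ! j) \<noteq> {} \<longrightarrow> L i < L j)"

definition depth :: "circuit \<Rightarrow> nat" where
  "depth c = (LEAST d. \<exists>L. layering c d L)"

lemma layering_exists: "\<exists>L. layering c (length c) L"
  by (rule exI[of _ "\<lambda>i. i"]) (auto simp: layering_def)

lemma depth_le: "layering c d L \<Longrightarrow> depth c \<le> d"
  unfolding depth_def by (rule Least_le) blast

lemma layering_depth: "\<exists>L. layering c (depth c) L"
  unfolding depth_def by (rule LeastI_ex) (use layering_exists in blast)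

(* C^nX: the controls are the qubits 0, ..., n - 1 and the target is qubit n. *)
definition toffoli_mat :: "nat \<Rightarrow> complex mat" where
  "toffoli_mat n = mat (2 ^ (n + 1)) (2 ^ (n + 1)) (\<lambda>(i, j).
     of_bool (i = (if \<forall>k<n. bit j k then flip_bit n j else j)))"

definition relative_phase_toffoli :: "nat \<Rightarrow> complex mat \<Rightarrow> bool" where
  "relative_phase_toffoli n U \<longleftrightarrow>
     (\<exists>D. unitary_mat (2 ^ (n + 1)) D \<and> diagonal_mat D \<and> U = D * toffoli_mat n)"

end

theory Submission
  imports Defs
begin

text \<open>
  Two controls \<open>b\<^sub>0, b\<^sub>1\<close> serve as conditionally clean ancillas. Let \<open>U\<close> be a classical reversible
  circuit, up to phases, on the controls such that for \<open>b\<^sub>0 = b\<^sub>1 = 1\<close> all controls are 1 iff after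
  \<open>U\<close> at most two designated qubits \<open>F\<close> are 1. Conjugating by \<open>U\<close> a rotation \<open>diag(i, -i)\<close> of the
  target controlled by \<open>F\<close> cancels the phases of \<open>U\<close> and leaves a controlled diagonal gate on the
  target. Conjugating this further by a rotation of the target by \<open>\<pi>/4\<close> controlled by \<open>b\<^sub>0, b\<^sub>1\<close>
  gives \<open>iX\<close> if all controls are 1 and a diagonal gate otherwise: for \<open>b\<^sub>0 b\<^sub>1 = 0\<close> it does not matter
  what \<open>U\<close> computes.

  \<open>U\<close> consists of relative-phase Toffoli gates with three CNOTs each, every one of which merges two
  tested qubits into a conditionally clean one; so there are at most \<open>n - 2\<close> of them. A merge makes
  its two operands conditionally clean, so levels of about \<open>1, 2, 4, \<dots>\<close> qubits can be merged along
  binary trees, the targets for one level being the operands and inner nodes of the level below.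
  Running the trees of all levels as a pipeline takes \<open>O(log n)\<close> rounds and leaves one value per level;
  these are merged one by one, from the top level downwards.
\<close>

subsection \<open>Two-by-two matrices\<close>

definition mat2 :: "complex \<Rightarrow> complex \<Rightarrow> complex \<Rightarrow> complex \<Rightarrow> complex mat" where
  "mat2 a b c d = mat 2 2 (\<lambda>(i, j). if i = 0 then if j = 0 then a else b else if j = 0 then c else d)"

lemma mat2_carrier [simp]: "mat2 a b c d \<in> carrier_mat 2 2"
  by (simp add: mat2_def)

lemma mat2_index [simp]:
  "mat2 a b c d $$ (of_bool p, of_bool q) = (if p then if q then d else c else if q then b else a)"
  by (simp add: mat2_def)

lemma mat2_index_nat [simp]:
  "mat2 a b c d $$ (0, 0) = a" "mat2 a b c d $$ (0, Suc 0) = b"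
  "mat2 a b c d $$ (Suc 0, 0) = c" "mat2 a b c d $$ (Suc 0, Suc 0) = d"
  by (simp_all add: mat2_def)

lemma mat2_eq_iff [simp]: "mat2 a b c d = mat2 a' b' c' d' \<longleftrightarrow> a = a' \<and> b = b' \<and> c = c' \<and> d = d'"
  by (metis mat2_index_nat)

lemma mat2_mult [simp]:
  "mat2 a b c d * mat2 a' b' c' d' =
   mat2 (a * a' + b * c') (a * b' + b * d') (c * a' + d * c') (c * b' + d * d')"
  by (rule eq_matI) (auto simp: mat2_def scalar_prod_def numeral_2_eq_2 less_Suc_eq)

lemma mult_carrier_2 [simp]:
  "A \<in> carrier_mat 2 2 \<Longrightarrow> B \<in> carrier_mat 2 2 \<Longrightarrow> A * B \<in> carrier_mat 2 2"
  by (rule mult_carrier_mat)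

lemmas assoc_mult_2 = assoc_mult_mat[of _ 2 2 _ 2 _ 2]
  and mult_one_2 = left_mult_one_mat[of _ 2 2] right_mult_one_mat[of _ 2 2]

lemma one_mat_2: "1\<^sub>m 2 = mat2 1 0 0 1"
  by (rule eq_matI) (auto simp: mat2_def less_Suc_eq numeral_2_eq_2)

lemma adjoint_mat2 [simp]: "mat_adjoint (mat2 a b c d) = mat2 (cnj a) (cnj c) (cnj b) (cnj d)"
  by (rule eq_matI)
     (auto simp: mat2_def mat_adjoint_def mat_of_rows_def cols_def less_Suc_eq numeral_2_eq_2)

lemma unitary_mat_adjoint:
  assumes "unitary_mat d U" shows "unitary_mat d (mat_adjoint U)"
proof -
  have U: "U \<in> carrier_mat d d" using assms by (simp add: unitary_mat_def)
  then have "mat_adjoint U \<in> carrier_mat d d"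
    by (auto simp: mat_adjoint_def mat_of_rows_def)
  moreover have "mat_adjoint (mat_adjoint U) = U"
    using U by (intro eq_matI) (auto simp: mat_adjoint_def mat_of_rows_def cols_def)
  ultimately show ?thesis using assms by (simp add: unitary_mat_def)
qed

definition pauli_X :: "complex mat" where
  "pauli_X = mat2 0 1 1 0"

text \<open>The angle is that of the real plane, half of the Bloch sphere angle:
  \<open>rot_y (pi / 2)\<close> is already antidiagonal, and \<open>rot_z (pi / 2)\<close> is
  diag(i, -i).\<close>

definition rot_y :: "real \<Rightarrow> complex mat" where
  "rot_y \<theta> = mat2 (cos \<theta>) (- sin \<theta>) (sin \<theta>) (cos \<theta>)"

definition rot_z :: "real \<Rightarrow> complex mat" where
  "rot_z \<theta> = mat2 (cis \<theta>) 0 0 (cis (- \<theta>))"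

text \<open>The two properties of rotations about an axis orthogonal to the \<open>X\<close> axis that
  multiplexing with CNOT gates relies on.\<close>

definition rotation_family :: "(real \<Rightarrow> complex mat) \<Rightarrow> bool" where
  "rotation_family \<rho> \<longleftrightarrow> (\<forall>a. unitary_mat 2 (\<rho> a)) \<and> \<rho> 0 = 1\<^sub>m 2 \<and>
     (\<forall>a b. \<rho> a * \<rho> b = \<rho> (a + b)) \<and> (\<forall>a. pauli_X * \<rho> a = \<rho> (- a) * pauli_X)"

lemma pauli_X_carrier [simp]: "pauli_X \<in> carrier_mat 2 2"
  by (simp add: pauli_X_def)

lemma pauli_X_squared [simp]: "pauli_X * pauli_X = 1\<^sub>m 2"
  by (simp add: pauli_X_def one_mat_2)

lemma unitary_pauli_X: "unitary_mat 2 pauli_X"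
  by (simp add: unitary_mat_def pauli_X_def one_mat_2)

lemma rotation_family_rot_y: "rotation_family rot_y"
proof -
  have "complex_of_real (cos a) * complex_of_real (cos a) +
      complex_of_real (sin a) * complex_of_real (sin a) = 1" for a
    by (metis of_real_1 of_real_add of_real_mult sin_cos_squared_add3)
  then show ?thesis
    unfolding rotation_family_def
    by (auto simp: rot_y_def one_mat_2 unitary_mat_def pauli_X_def cos_add sin_add algebra_simps)
qed

lemma rotation_family_rot_z: "rotation_family rot_z"
  unfolding rotation_family_def
  by (auto simp: rot_z_def one_mat_2 unitary_mat_def pauli_X_def cis_mult cis_cnj)

subsection \<open>Multiplexed operators\<close>

text \<open>The operator that applies to qubit \<open>t\<close> the matrix \<open>G y\<close>, where \<open>y\<close> is the assignment of the
  remaining qubits; it is meaningful only if \<open>G y\<close> does not depend on \<open>y t\<close>.\<close>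

definition multiplexed :: "nat \<Rightarrow> nat \<Rightarrow> ((nat \<Rightarrow> bool) \<Rightarrow> complex mat) \<Rightarrow> complex mat" where
  "multiplexed N t G = mat (2 ^ N) (2 ^ N) (\<lambda>(i, j).
     if \<forall>k<N. k \<noteq> t \<longrightarrow> bit i k = bit j k
     then G (bit j) $$ (of_bool (bit i t), of_bool (bit j t)) else 0)"

lemma multiplexed_carrier [simp]: "multiplexed N t G \<in> carrier_mat (2 ^ N) (2 ^ N)"
  by (simp add: multiplexed_def)

lemma multiplexed_cong: "(\<And>y. G y = H y) \<Longrightarrow> multiplexed N t G = multiplexed N t H"
  by (metis ext)

lemma bit_less_power: "i < 2 ^ N \<Longrightarrow> bit i k \<Longrightarrow> k < N" for i :: nat
  by (metis bit_take_bit_iff take_bit_nat_eq_self)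

lemma nat_eq_bitI: "(i::nat) = j" if "i < 2 ^ N" "j < 2 ^ N" "\<And>k. k < N \<Longrightarrow> bit i k = bit j k"
  by (rule bit_eqI) (use that bit_less_power in blast)

lemma flip_bit_less: "flip_bit t j < 2 ^ N" if "j < 2 ^ N" "t < N" for j :: nat
  using that take_bit_flip_bit_eq[of N t j] by (metis leD take_bit_nat_eq_self take_bit_nat_less_exp)

lemma bit_flip_bit_nat [simp]: "bit (flip_bit t j) k = (if k = t then \<not> bit j k else bit j k)" for j :: nat
  by (auto simp: bit_flip_bit_iff)

lemma flip_bit_flip_bit [simp]: "flip_bit t (flip_bit t j) = j" for j :: nat
  by (rule bit_eqI) auto

lemma agree_off_cases:
  fixes i j :: nat
  assumes "i < 2 ^ N" "j < 2 ^ N" "t < N" "\<forall>k<N. k \<noteq> t \<longrightarrow> bit i k = bit j k"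
  shows "i = (if bit i t = bit j t then j else flip_bit t j)"
  using assms by (intro nat_eq_bitI[of _ N]) (auto simp: flip_bit_less)

lemma agree_off_bit_upd:
  fixes i j :: nat
  assumes "i < 2 ^ N" "j < 2 ^ N" "\<forall>k<N. k \<noteq> t \<longrightarrow> bit i k = bit j k"
  shows "(bit i)(t := b) = (bit j)(t := b)"
proof
  fix k
  show "((bit i)(t := b)) k = ((bit j)(t := b)) k"
    using assms bit_less_power[of i N k] bit_less_power[of j N k] by (cases "k < N") auto
qed

definition independent_of :: "nat \<Rightarrow> ((nat \<Rightarrow> bool) \<Rightarrow> 'a) \<Rightarrow> bool" where
  "independent_of t G \<longleftrightarrow> (\<forall>y b. G (y(t := b)) = G y)"

text \<open>Row and column index of a nonzero entry of a multiplexed operator differ at most in bit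
  \<open>t\<close>, so under independence either of them may be used to evaluate \<open>G\<close>;
  \<open>multiplexed\<close> takes the column.\<close>

lemma independent_of_agree:
  fixes i j :: nat
  assumes "independent_of t G" "i < 2 ^ N" "j < 2 ^ N" "\<forall>k<N. k \<noteq> t \<longrightarrow> bit i k = bit j k"
  shows "G (bit i) = G (bit j)"
  using agree_off_bit_upd[OF assms(2-4), of False] assms(1) unfolding independent_of_def by metis

text \<open>Only the states that agree with the column \<open>j\<close> off qubit \<open>t\<close>
  contribute to the sum, namely \<open>j\<close> and \<open>flip_bit t j\<close>; what remains is a
  two-by-two product. The left factor is also evaluated at \<open>flip_bit t j\<close>, hence the
  independence of \<open>G\<close>.\<close>

lemma multiplexed_mult:
  assumes t: "t < N" and G: "\<And>y. G y \<in> carrier_mat 2 2" and H: "\<And>y. H y \<in> carrier_mat 2 2"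
    and indep: "independent_of t G"
  shows "multiplexed N t G * multiplexed N t H = multiplexed N t (\<lambda>y. G y * H y)"
proof (rule eq_matI)
  fix i j assume "i < dim_row (multiplexed N t (\<lambda>y. G y * H y))"
    "j < dim_col (multiplexed N t (\<lambda>y. G y * H y))"
  then have i: "i < 2 ^ N" and j: "j < 2 ^ N" by (simp_all add: multiplexed_def)
  let ?P = "\<lambda>i j. \<forall>k<N. k \<noteq> t \<longrightarrow> bit (i::nat) k = bit (j::nat) k"
  define g where "g k = (if ?P i k then G (bit k) $$ (of_bool (bit i t), of_bool (bit k t)) else 0)
    * (if ?P k j then H (bit j) $$ (of_bool (bit k t), of_bool (bit j t)) else 0)" for k
  have "(multiplexed N t G * multiplexed N t H) $$ (i, j) = (\<Sum>k\<in>{0..<2 ^ N}. g k)"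
    using i j by (simp add: multiplexed_def scalar_prod_def g_def)
  also have "\<dots> = (\<Sum>k\<in>{j, flip_bit t j}. g k)"
  proof (rule sum.mono_neutral_right)
    show "\<forall>k\<in>{0..<2 ^ N} - {j, flip_bit t j}. g k = 0"
    proof
      fix k assume k: "k \<in> {0..<2 ^ N} - {j, flip_bit t j}"
      then have "\<not> ?P k j" using agree_off_cases[of k N j t] j t
        by (metis DiffE atLeastLessThan_iff insertCI)
      then show "g k = 0" unfolding g_def by (simp only: if_False mult_zero_right)
    qed
  qed (use j t flip_bit_less in auto)
  also have "\<dots> = g j + g (flip_bit t j)"
  proof -
    have "j \<noteq> flip_bit t j" by (metis bit_flip_bit_nat)
    then show ?thesis by simp
  qed
  also have "\<dots> = multiplexed N t (\<lambda>y. G y * H y) $$ (i, j)"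
  proof (cases "?P i j")
    case True
    have F: "flip_bit t j < 2 ^ N" using j t flip_bit_less by simp
    have a: "G (bit (flip_bit t j)) = G (bit j)"
      by (rule independent_of_agree[OF indep F j]) simp
    \<comment> \<open>Putting \<open>q\<close> before its complement matches the order
      \<open>g j + g (flip_bit t j)\<close> when \<open>q\<close> is bit \<open>t\<close> of
      \<open>j\<close>.\<close>
    have *: "(A * B) $$ (of_bool p, of_bool r) =
       A $$ (of_bool p, of_bool q) * B $$ (of_bool q, of_bool r) +
       A $$ (of_bool p, of_bool (\<not> q)) * B $$ (of_bool (\<not> q), of_bool r)"
      if "A \<in> carrier_mat 2 2" "B \<in> carrier_mat 2 2" for A B :: "complex mat" and p q r :: bool
      using that by (cases q) (simp_all add: scalar_prod_def numeral_2_eq_2)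
    show ?thesis using True i j *[OF G H, of "bit j" "bit j" "bit i t" "bit j t" "bit j t"]
      by (simp add: g_def multiplexed_def a)
  next
    case False
    then show ?thesis using i j by (auto simp: g_def multiplexed_def)
  qed
  finally show "(multiplexed N t G * multiplexed N t H) $$ (i, j) =
    multiplexed N t (\<lambda>y. G y * H y) $$ (i, j)" .
qed (simp_all add: multiplexed_def)

lemma multiplexed_one: "t < N \<Longrightarrow> multiplexed N t (\<lambda>_. 1\<^sub>m 2) = 1\<^sub>m (2 ^ N)"
proof (rule eq_matI)
  fix i j assume t: "t < N" and "i < dim_row (1\<^sub>m (2 ^ N))" "j < dim_col (1\<^sub>m (2 ^ N))"
  then have i: "i < 2 ^ N" and j: "j < 2 ^ N" by simp_all
  show "multiplexed N t (\<lambda>_. 1\<^sub>m 2) $$ (i, j) = 1\<^sub>m (2 ^ N) $$ (i, j)"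
    using i j agree_off_cases[OF i j t] by (auto simp: multiplexed_def)
qed (simp_all add: multiplexed_def)

lemma gate_mat_Single: "gate_mat N (Single q U) = multiplexed N q (\<lambda>_. U)"
  by (simp add: multiplexed_def)

lemma gate_mat_CNOT:
  assumes "c < N" "t < N" "c \<noteq> t"
  shows "gate_mat N (CNOT c t) = multiplexed N t (\<lambda>y. if y c then pauli_X else 1\<^sub>m 2)"
proof (rule eq_matI)
  fix i j assume "i < dim_row (multiplexed N t (\<lambda>y. if y c then pauli_X else 1\<^sub>m 2))"
    "j < dim_col (multiplexed N t (\<lambda>y. if y c then pauli_X else 1\<^sub>m 2))"
  then have i: "i < 2 ^ N" and j: "j < 2 ^ N" by (simp_all add: multiplexed_def)
  have "(\<forall>k<N. k \<noteq> t \<longrightarrow> bit i k = bit j k) \<and> bit i t = (bit j t \<noteq> bit j c)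
     \<longleftrightarrow> i = (if bit j c then flip_bit t j else j)"
    using agree_off_cases[OF i j assms(2)] by auto
  then show "gate_mat N (CNOT c t) $$ (i, j) =
      multiplexed N t (\<lambda>y. if y c then pauli_X else 1\<^sub>m 2) $$ (i, j)"
    using i j by (auto simp: multiplexed_def pauli_X_def one_mat_2)
qed (simp_all add: multiplexed_def)

subsection \<open>Circuits acting on one target qubit\<close>

primrec gate_block :: "gate \<Rightarrow> (nat \<Rightarrow> bool) \<Rightarrow> complex mat" where
  "gate_block (Single q U) y = U"
| "gate_block (CNOT c t) y = (if y c then pauli_X else 1\<^sub>m 2)"

primrec circuit_block :: "circuit \<Rightarrow> (nat \<Rightarrow> bool) \<Rightarrow> complex mat" where
  "circuit_block [] y = 1\<^sub>m 2"
| "circuit_block (g # c) y = circuit_block c y * gate_block g y"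

primrec targets :: "nat \<Rightarrow> gate \<Rightarrow> bool" where
  "targets t (Single q U) \<longleftrightarrow> q = t"
| "targets t (CNOT c t') \<longleftrightarrow> t' = t"

lemma valid_circuit_append [simp]:
  "valid_circuit N (a @ b) \<longleftrightarrow> valid_circuit N a \<and> valid_circuit N b"
  by (auto simp: valid_circuit_def)

lemma valid_circuit_Cons [simp]:
  "valid_circuit N (g # c) \<longleftrightarrow> valid_gate N g \<and> valid_circuit N c"
  by (auto simp: valid_circuit_def)

lemma valid_circuit_Nil [simp]: "valid_circuit N []"
  by (simp add: valid_circuit_def)

lemma cnot_count_append [simp]: "cnot_count (a @ b) = cnot_count a + cnot_count b"
  by (simp add: cnot_count_def)

lemma cnot_count_Cons [simp]: "cnot_count (g # c) = (if is_CNOT g then 1 else 0) + cnot_count c"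
  by (simp add: cnot_count_def)

lemma cnot_count_Nil [simp]: "cnot_count [] = 0"
  by (simp add: cnot_count_def)

lemma gate_mat_carrier [simp]: "gate_mat N g \<in> carrier_mat (2 ^ N) (2 ^ N)"
  by (cases g) simp_all

lemma circuit_mat_carrier [simp]: "circuit_mat N c \<in> carrier_mat (2 ^ N) (2 ^ N)"
  by (induction c) (auto intro: mult_carrier_mat)

lemma circuit_mat_append: "circuit_mat N (a @ b) = circuit_mat N b * circuit_mat N a"
proof (induction a)
  case Nil
  show ?case by (simp add: right_mult_one_mat[OF circuit_mat_carrier])
next
  case (Cons g a)
  show ?case
    by (simp add: Cons.IH assoc_mult_mat[OF circuit_mat_carrier circuit_mat_carrier gate_mat_carrier])
qed

lemma gate_block_carrier: "valid_gate N g \<Longrightarrow> gate_block g y \<in> carrier_mat 2 2"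
  by (cases g) (auto simp: unitary_mat_def)

lemma circuit_block_carrier: "valid_circuit N c \<Longrightarrow> circuit_block c y \<in> carrier_mat 2 2"
  by (induction c) (auto intro!: mult_carrier_mat gate_block_carrier)

lemma circuit_block_append:
  assumes "valid_circuit N a" "valid_circuit N b"
  shows "circuit_block (a @ b) y = circuit_block b y * circuit_block a y"
  using assms
proof (induction a)
  case Nil
  then show ?case by (simp add: right_mult_one_mat[OF circuit_block_carrier])
next
  case (Cons g a)
  then show ?case
    by (simp add: assoc_mult_2 circuit_block_carrier[of N] gate_block_carrier[of N])
qed

lemma circuit_block_independent:
  assumes "valid_circuit N c" "\<forall>g\<in>set c. targets t g"
  shows "independent_of t (circuit_block c)"
  unfolding independent_of_def
proof (intro allI)
  fix y b
  have "gate_block g (y(t := b)) = gate_block g y" if "valid_gate N g" "targets t g" for g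
    using that by (cases g) auto
  then show "circuit_block c (y(t := b)) = circuit_block c y"
    using assms by (induction c) auto
qed

text \<open>In a valid circuit a control differs from the target \<open>t\<close>, so all blocks are
  independent of bit \<open>t\<close> and \<open>multiplexed_mult\<close> applies gate by gate.
  Circuits with a single target thus reduce to two-by-two products.\<close>

lemma circuit_mat_eq_multiplexed:
  assumes "t < N" "valid_circuit N c" "\<forall>g\<in>set c. targets t g"
  shows "circuit_mat N c = multiplexed N t (circuit_block c)"
  using assms(2,3)
proof (induction c)
  case Nil
  then show ?case
    using multiplexed_one[OF assms(1)] by (simp add: multiplexed_cong[of "circuit_block []" "\<lambda>_. 1\<^sub>m 2"])
next
  case (Cons g c)
  have g: "gate_mat N g = multiplexed N t (gate_block g)"
  proof (cases g)
    case (Single q U)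
    then show ?thesis using Cons.prems
      by (auto simp: gate_mat_Single simp del: gate_mat.simps intro!: multiplexed_cong)
  next
    case (CNOT a b)
    then show ?thesis using Cons.prems
      by (auto simp: gate_mat_CNOT simp del: gate_mat.simps intro!: multiplexed_cong)
  qed
  have "circuit_mat N (g # c) = multiplexed N t (circuit_block c) * multiplexed N t (gate_block g)"
    using Cons g by simp
  also have "\<dots> = multiplexed N t (\<lambda>y. circuit_block c y * gate_block g y)"
    using Cons.prems assms(1)
    by (intro multiplexed_mult circuit_block_carrier circuit_block_independent gate_block_carrier) auto
  finally show ?case by (simp add: multiplexed_def)
qed

subsection \<open>Inverse circuits\<close>

primrec gate_inverse :: "gate \<Rightarrow> gate" where
  "gate_inverse (Single q U) = Single q (mat_adjoint U)"
| "gate_inverse (CNOT c t) = CNOT c t"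

definition circuit_inverse :: "circuit \<Rightarrow> circuit" where
  "circuit_inverse c = rev (map gate_inverse c)"

lemma circuit_inverse_Cons: "circuit_inverse (g # c) = circuit_inverse c @ [gate_inverse g]"
  by (simp add: circuit_inverse_def)

lemma valid_gate_inverse: "valid_gate N g \<Longrightarrow> valid_gate N (gate_inverse g)"
  by (cases g) (auto simp: unitary_mat_adjoint)

lemma valid_circuit_inverse: "valid_circuit N c \<Longrightarrow> valid_circuit N (circuit_inverse c)"
  by (auto simp: valid_circuit_def circuit_inverse_def valid_gate_inverse)

lemma cnot_count_inverse: "cnot_count (circuit_inverse c) = cnot_count c"
proof -
  have "is_CNOT (gate_inverse g) = is_CNOT g" for g by (cases g) auto
  then show ?thesis by (induction c) (auto simp: circuit_inverse_def)
qed

text \<open>A gate and its inverse share a target, so the pair is a multiplexed operator and only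
  its blocks have to cancel.\<close>

lemma gate_mat_inverse:
  assumes "valid_gate N g"
  shows "gate_mat N (gate_inverse g) * gate_mat N g = 1\<^sub>m (2 ^ N)"
proof -
  obtain t where t: "t < N" "targets t g" "targets t (gate_inverse g)"
    using assms by (cases g) auto
  have "gate_mat N (gate_inverse g) * gate_mat N g = circuit_mat N [g, gate_inverse g]"
    by (simp add: left_mult_one_mat[OF gate_mat_carrier])
  also have "\<dots> = multiplexed N t (circuit_block [g, gate_inverse g])"
    using t assms by (intro circuit_mat_eq_multiplexed) (auto simp: valid_gate_inverse)
  also have "\<dots> = multiplexed N t (\<lambda>_. 1\<^sub>m 2)"
  proof (rule multiplexed_cong)
    fix y show "circuit_block [g, gate_inverse g] y = 1\<^sub>m 2"
      using assms valid_gate_inverse[OF assms]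
      by (cases g) (auto simp: unitary_mat_def mult_one_2)
  qed
  finally show ?thesis using multiplexed_one[OF t(1)] by simp
qed

lemma circuit_mat_inverse:
  assumes "valid_circuit N c"
  shows "circuit_mat N (circuit_inverse c) * circuit_mat N c = 1\<^sub>m (2 ^ N)"
  using assms
proof (induction c)
  case Nil
  then show ?case by (simp add: circuit_inverse_def)
next
  case (Cons g c)
  let ?n = "2 ^ N"
  let ?I = "circuit_mat N (circuit_inverse c)" and ?c = "circuit_mat N c"
  let ?h = "gate_mat N (gate_inverse g)" and ?g = "gate_mat N g"
  have [simp]: "?I \<in> carrier_mat ?n ?n" "?c \<in> carrier_mat ?n ?n" "?h \<in> carrier_mat ?n ?n"
    "?g \<in> carrier_mat ?n ?n" by simp_all
  have "circuit_mat N (circuit_inverse (g # c)) * circuit_mat N (g # c) = (?h * ?I) * (?c * ?g)"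
    by (simp add: circuit_inverse_Cons circuit_mat_append left_mult_one_mat[OF gate_mat_carrier])
  also have "\<dots> = ?h * (?I * (?c * ?g))"
    by (rule assoc_mult_mat[of _ ?n ?n _ ?n _ ?n]) (auto intro!: mult_carrier_mat[of _ ?n ?n])
  also have "?I * (?c * ?g) = (?I * ?c) * ?g"
    by (rule assoc_mult_mat[of _ ?n ?n _ ?n _ ?n, symmetric]) auto
  also have "?I * ?c = 1\<^sub>m ?n" using Cons by simp
  also have "1\<^sub>m ?n * ?g = ?g" by (rule left_mult_one_mat[OF gate_mat_carrier])
  also have "?h * ?g = 1\<^sub>m ?n" using Cons.prems by (simp add: gate_mat_inverse)
  finally show ?case .
qed

subsection \<open>Multiplexed rotations\<close>

text \<open>The CNOT gates negate the second half angle if \<open>c\<close> is 1: the two halves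
  then add up, and otherwise they cancel. The number of gates roughly doubles with every control;
  the final circuits use at most two.\<close>

fun controlled_rotation ::
  "(real \<Rightarrow> complex mat) \<Rightarrow> nat \<Rightarrow> nat list \<Rightarrow> real \<Rightarrow> circuit" where
  "controlled_rotation \<rho> t [] \<theta> = [Single t (\<rho> \<theta>)]"
| "controlled_rotation \<rho> t (c # cs) \<theta> =
     controlled_rotation \<rho> t cs (\<theta> / 2) @ [CNOT c t] @
     controlled_rotation \<rho> t cs (- \<theta> / 2) @ [CNOT c t]"

lemma controlled_rotation_targets: "g \<in> set (controlled_rotation \<rho> t cs \<theta>) \<Longrightarrow> targets t g"
  by (induction \<rho> t cs \<theta> rule: controlled_rotation.induct) auto

lemma controlled_rotation_valid:
  assumes "rotation_family \<rho>" "t < N" "\<forall>c\<in>set cs. c < N \<and> c \<noteq> t"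
  shows "valid_circuit N (controlled_rotation \<rho> t cs \<theta>)"
  using assms by (induction \<rho> t cs \<theta> rule: controlled_rotation.induct) (auto simp: rotation_family_def)

lemma length_controlled_rotation:
  "length (controlled_rotation \<rho> t cs \<theta>) + 2 = 3 * 2 ^ length cs"
  by (induction \<rho> t cs \<theta> rule: controlled_rotation.induct) auto

lemma cnot_count_controlled_rotation:
  "cnot_count (controlled_rotation \<rho> t cs \<theta>) + 2 = 2 * 2 ^ length cs"
  by (induction \<rho> t cs \<theta> rule: controlled_rotation.induct) auto

lemma rotation_family_carrier: "rotation_family \<rho> \<Longrightarrow> \<rho> a \<in> carrier_mat 2 2"
  by (simp add: rotation_family_def unitary_mat_def)

text \<open>The trailing factor \<open>B\<close> puts X rho(a) X = rho(-a) into the right-nested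
  shape that \<open>assoc_mult_2\<close> produces.\<close>

lemma rotation_family_conj:
  assumes "rotation_family \<rho>" and B: "B \<in> carrier_mat 2 2"
  shows "pauli_X * (\<rho> a * (pauli_X * B)) = \<rho> (- a) * B"
proof -
  have [simp]: "\<rho> a \<in> carrier_mat 2 2" for a
    using assms(1) by (rule rotation_family_carrier)
  have "pauli_X * (\<rho> a * (pauli_X * B)) = ((pauli_X * \<rho> a) * pauli_X) * B"
    using B by (simp add: assoc_mult_2)
  also have "\<dots> = ((\<rho> (- a) * pauli_X) * pauli_X) * B"
    using assms by (simp add: rotation_family_def)
  also have "\<dots> = (\<rho> (- a) * (pauli_X * pauli_X)) * B"
    by (simp only: assoc_mult_2 pauli_X_carrier \<open>\<And>a. \<rho> a \<in> carrier_mat 2 2\<close>)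
  finally show ?thesis by (simp add: mult_one_2)
qed

lemma circuit_block_controlled_rotation:
  assumes \<rho>: "rotation_family \<rho>" and "t < N" "\<forall>c\<in>set cs. c < N \<and> c \<noteq> t"
  shows "circuit_block (controlled_rotation \<rho> t cs \<theta>) y = (if \<forall>c\<in>set cs. y c then \<rho> \<theta> else 1\<^sub>m 2)"
  using assms(3)
proof (induction cs arbitrary: \<theta>)
  case Nil
  then show ?case by (simp add: left_mult_one_mat[OF rotation_family_carrier[OF \<rho>]])
next
  case (Cons c cs)
  have [simp]: "\<rho> a \<in> carrier_mat 2 2" for a
    using \<rho> by (rule rotation_family_carrier)
  have add: "\<rho> a * \<rho> b = \<rho> (a + b)" and zero: "\<rho> 0 = 1\<^sub>m 2" for a b
    using \<rho> by (auto simp: rotation_family_def)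
  have valid: "valid_circuit N (controlled_rotation \<rho> t cs \<theta>)" for \<theta>
    using Cons.prems \<rho> assms(2) by (intro controlled_rotation_valid) auto
  define K where "K = (if y c then pauli_X else 1\<^sub>m 2)"
  have K: "K \<in> carrier_mat 2 2" "K * K = 1\<^sub>m 2" by (auto simp: K_def)
  let ?A = "\<lambda>\<theta>. circuit_block (controlled_rotation \<rho> t cs \<theta>) y"
  have A: "?A \<theta> = (if \<forall>c\<in>set cs. y c then \<rho> \<theta> else 1\<^sub>m 2)" for \<theta>
    using Cons by auto
  have [simp]: "?A \<theta> \<in> carrier_mat 2 2" for \<theta> by (simp add: A)
  have "circuit_block (controlled_rotation \<rho> t (c # cs) \<theta>) y
      = ((K * ?A (- \<theta> / 2)) * K) * ?A (\<theta> / 2)"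
    using valid Cons.prems assms(2) K
    by (simp add: circuit_block_append[of N] flip: K_def)
  also have "\<dots> = K * (?A (- \<theta> / 2) * (K * ?A (\<theta> / 2)))"
    using K(1) by (simp add: assoc_mult_2)
  also have "\<dots> = (if \<forall>c\<in>set (c # cs). y c then \<rho> \<theta> else 1\<^sub>m 2)"
    using K by (auto simp: A K_def rotation_family_conj[OF \<rho>] add zero mult_one_2)
  finally show ?case .
qed

subsection \<open>Relative-phase merges\<close>

text \<open>A target that holds 1 receives the conjunction of the controls; this is why clean qubits
  hold 1 rather than 0 below.\<close>

fun merge_bits :: "nat \<times> nat \<times> nat \<Rightarrow> (nat \<Rightarrow> bool) \<Rightarrow> nat \<Rightarrow> bool" where
  "merge_bits (u, v, w) y = y(w := (y w \<longleftrightarrow> y u \<and> y v))"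

text \<open>The counterpart of \<open>merge_bits\<close> on the indices of matrices: a Toffoli gate
  followed by X on \<open>w\<close>.\<close>

fun merge_index :: "nat \<times> nat \<times> nat \<Rightarrow> nat \<Rightarrow> nat" where
  "merge_index (u, v, w) j = (if bit j u \<and> bit j v then j else flip_bit w j)"

text \<open>Margolus' three-CNOT circuit, followed by \<open>X\<close>.\<close>

fun merge_circuit :: "nat \<times> nat \<times> nat \<Rightarrow> circuit" where
  "merge_circuit (u, v, w) =
    [Single w (rot_y (- pi / 8)), CNOT u w, Single w (rot_y (- pi / 8)), CNOT v w,
     Single w (rot_y (pi / 8)), CNOT u w, Single w (rot_y (pi / 8)), Single w pauli_X]"

primrec merges_bits :: "(nat \<times> nat \<times> nat) list \<Rightarrow> (nat \<Rightarrow> bool) \<Rightarrow> nat \<Rightarrow> bool" where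
  "merges_bits [] y = y"
| "merges_bits (m # ms) y = merges_bits ms (merge_bits m y)"

definition merges_circuit :: "(nat \<times> nat \<times> nat) list \<Rightarrow> circuit" where
  "merges_circuit ms = concat (map merge_circuit ms)"

fun merge_below :: "nat \<Rightarrow> nat \<times> nat \<times> nat \<Rightarrow> bool" where
  "merge_below n (u, v, w) \<longleftrightarrow> u < n \<and> v < n \<and> w < n \<and> u \<noteq> v \<and> u \<noteq> w \<and> v \<noteq> w"

lemma merge_circuit_valid: "merge_below n m \<Longrightarrow> n \<le> N \<Longrightarrow> valid_circuit N (merge_circuit m)"
  using rotation_family_rot_y unitary_pauli_X by (cases m) (auto simp: rotation_family_def)

text \<open>Moving every X to the right across the rotations negates their angles. The angles then
  cancel unless \<open>v\<close> alone is set, where they add up to -pi/2; the sign in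
  \<open>rot_y (- pi / 2)\<close> is the only relative phase of a merge.\<close>

lemma circuit_block_merge:
  "circuit_block (merge_circuit (u, v, w)) y =
   (if y u \<and> y v then 1\<^sub>m 2 else if y v then rot_y (- pi / 2) else pauli_X)"
proof -
  note \<rho> = rotation_family_rot_y
  have [simp]: "rot_y a \<in> carrier_mat 2 2" for a
    using \<rho> by (rule rotation_family_carrier)
  have add: "rot_y a * rot_y b = rot_y (a + b)" and zero: "rot_y 0 = 1\<^sub>m 2"
    and X: "pauli_X * rot_y a = rot_y (- a) * pauli_X" for a b
    using \<rho> by (auto simp: rotation_family_def)
  have add': "rot_y a * (rot_y b * B) = rot_y (a + b) * B" if "B \<in> carrier_mat 2 2" for a b B
    using that by (simp add: add flip: assoc_mult_2)
  have X': "pauli_X * (rot_y a * B) = rot_y (- a) * (pauli_X * B)"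
    if "B \<in> carrier_mat 2 2" for a B
    using that assoc_mult_2[of pauli_X "rot_y a" B] by (simp add: X assoc_mult_2)
  have XX: "pauli_X * (pauli_X * B) = B" if "B \<in> carrier_mat 2 2" for B
    using that assoc_mult_2[of pauli_X pauli_X B] by (simp add: mult_one_2)
  show ?thesis
    by (cases "y u"; cases "y v") (simp_all add: assoc_mult_2 mult_one_2 add zero X add' X' XX)
qed

text \<open>Each block is diagonal or antidiagonal, so the circuit is a permutation matrix up to
  phases. That the phases ignore qubit \<open>t\<close> is what makes them cancel when an operator
  on \<open>t\<close> is conjugated.\<close>

lemma circuit_mat_merge:
  assumes m: "merge_below N (u, v, w)" and t: "t \<noteq> u" "t \<noteq> v" "t \<noteq> w"
  shows "\<exists>\<phi>. independent_of t \<phi> \<and> circuit_mat N (merge_circuit (u, v, w)) =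
      mat (2 ^ N) (2 ^ N) (\<lambda>(i, j). if i = merge_index (u, v, w) j then \<phi> (bit j) else 0)"
proof -
  define f where "f = merge_index (u, v, w)"
  define H where "H = circuit_block (merge_circuit (u, v, w))"
  \<comment> \<open>The entry in column \<open>y w\<close> and in the row of the new value of
    \<open>w\<close>, the only nonzero one of that column of the block.\<close>
  define \<phi> where "\<phi> y = H y $$ (of_bool (merge_bits (u, v, w) y w), of_bool (y w))" for y
  have "circuit_mat N (merge_circuit (u, v, w)) = multiplexed N w H"
    unfolding H_def using m by (intro circuit_mat_eq_multiplexed merge_circuit_valid[of N]) auto
  also have "\<dots> = mat (2 ^ N) (2 ^ N) (\<lambda>(i, j). if i = f j then \<phi> (bit j) else 0)"
  proof (rule eq_matI)
    fix i j
    assume "i < dim_row (mat (2 ^ N) (2 ^ N) (\<lambda>(i, j). if i = f j then \<phi> (bit j) else 0))"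
      "j < dim_col (mat (2 ^ N) (2 ^ N) (\<lambda>(i, j). if i = f j then \<phi> (bit j) else 0))"
    then have i: "i < 2 ^ N" and j: "j < 2 ^ N" by simp_all
    have fj: "f j < 2 ^ N" using j m by (simp add: f_def flip_bit_less)
    have "i = f j \<longleftrightarrow> (\<forall>k<N. k \<noteq> w \<longrightarrow> bit i k = bit j k) \<and> bit i w = bit (f j) w"
      using agree_off_cases[OF i j, of w] m by (auto simp: f_def split: if_splits)
    then show "multiplexed N w H $$ (i, j) =
        mat (2 ^ N) (2 ^ N) (\<lambda>(i, j). if i = f j then \<phi> (bit j) else 0) $$ (i, j)"
      using i j by (auto simp: multiplexed_def \<phi>_def H_def circuit_block_merge one_mat_2 rot_y_def
          pauli_X_def f_def simp del: merge_circuit.simps split: if_splits)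
  qed (simp_all add: multiplexed_def)
  finally have "circuit_mat N (merge_circuit (u, v, w)) =
      mat (2 ^ N) (2 ^ N) (\<lambda>(i, j). if i = f j then \<phi> (bit j) else 0)" .
  moreover have "independent_of t \<phi>"
    using t by (simp add: independent_of_def \<phi>_def H_def circuit_block_merge del: merge_circuit.simps)
  ultimately show ?thesis unfolding f_def by blast
qed

text \<open>The operator on \<open>t\<close> changes bit \<open>t\<close> only, and the phase of a
  merge does not depend on it. Both sides therefore carry the same phase, and only the permutation
  of the bits acts on the argument of \<open>G\<close>.\<close>

lemma conjugate_multiplexed_merge:
  assumes m: "merge_below N (u, v, w)" and t: "t < N" "t \<noteq> u" "t \<noteq> v" "t \<noteq> w"
    and G: "independent_of t G"
  shows "multiplexed N t G * circuit_mat N (merge_circuit (u, v, w)) =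
    circuit_mat N (merge_circuit (u, v, w)) * multiplexed N t (\<lambda>y. G (merge_bits (u, v, w) y))"
proof -
  define f where "f = merge_index (u, v, w)"
  obtain \<phi> where \<phi>: "circuit_mat N (merge_circuit (u, v, w)) =
      mat (2 ^ N) (2 ^ N) (\<lambda>(i, j). if i = f j then \<phi> (bit j) else 0)"
    and \<phi>_indep: "independent_of t \<phi>"
    using circuit_mat_merge[OF m t(2-4)] unfolding f_def by blast
  let ?M = "mat (2 ^ N) (2 ^ N) (\<lambda>(i, j). if i = f j then \<phi> (bit j) else 0)"
  let ?G' = "\<lambda>y. G (merge_bits (u, v, w) y)"
  let ?P = "\<lambda>i j. \<forall>k<N. k \<noteq> t \<longrightarrow> bit (i::nat) k = bit (j::nat) k"
  have f_less: "f j < 2 ^ N" if "j < 2 ^ N" for j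
    using that m by (simp add: f_def flip_bit_less)
  have f_f: "f (f j) = j" for j using m by (auto simp: f_def)
  \<comment> \<open>As \<open>f\<close> is an involution, the row condition \<open>i = f k\<close>
    becomes \<open>k = f i\<close>, which collapses the sum over \<open>k\<close> to one
    term.\<close>
  have f_iff: "i = f j \<longleftrightarrow> j = f i" for i j using f_f by metis
  have bit_f: "bit (f j) = merge_bits (u, v, w) (bit j)" for j
    by (rule ext) (auto simp: f_def)
  have agree_f: "?P (f i) (f j)" if "?P i j" for i j
    using that m t by (auto simp: bit_f)
  have "multiplexed N t G * ?M = ?M * multiplexed N t ?G'"
  proof (rule eq_matI)
    fix i j assume "i < dim_row (?M * multiplexed N t ?G')" "j < dim_col (?M * multiplexed N t ?G')"
    then have i: "i < 2 ^ N" and j: "j < 2 ^ N" by (simp_all add: multiplexed_def)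
    have dims: "dim_row (multiplexed N t H) = 2 ^ N" "dim_col (multiplexed N t H) = 2 ^ N" for H
      by (simp_all add: multiplexed_def)
    have "(multiplexed N t G * ?M) $$ (i, j) =
        (\<Sum>k\<in>{0..<2 ^ N}. multiplexed N t G $$ (i, k) * (if k = f j then \<phi> (bit j) else 0))"
      using i j by (simp add: dims scalar_prod_def)
    also have "\<dots> = (\<Sum>k\<in>{0..<2 ^ N}. if k = f j then multiplexed N t G $$ (i, k) * \<phi> (bit j) else 0)"
      by (rule sum.cong) auto
    also have "\<dots> = multiplexed N t G $$ (i, f j) * \<phi> (bit j)"
      using f_less[OF j] by simp
    \<comment> \<open>The core: where the entries are nonzero, \<open>f i\<close> and
      \<open>j\<close> agree off \<open>t\<close>, so \<open>\<phi>\<close> takes the same value at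
      both.\<close>
    also have "\<dots> = \<phi> (bit (f i)) * multiplexed N t ?G' $$ (f i, j)"
    proof (cases "?P i (f j)")
      case True
      then have *: "?P (f i) j" using agree_f[OF True] f_f by simp
      have "\<phi> (bit (f i)) = \<phi> (bit j)"
        by (rule independent_of_agree[OF \<phi>_indep f_less[OF i] j *])
      moreover have "bit (f i) t = bit i t" "bit (f j) t = bit j t" using t by (simp_all add: bit_f)
      moreover have "G (bit (f j)) = ?G' (bit j)" by (simp only: bit_f)
      ultimately show ?thesis
        using True * i j f_less[OF i] f_less[OF j] by (simp add: multiplexed_def del: merge_bits.simps)
    next
      case False
      then have "\<not> ?P (f i) j" using agree_f[of "f i" j] f_f by auto
      then show ?thesis using False i j f_less[OF i] f_less[OF j]
        unfolding multiplexed_def by (simp only: index_mat prod.case if_False) simp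
    qed
    also have "\<dots> = (\<Sum>k\<in>{0..<2 ^ N}. if k = f i then \<phi> (bit k) * multiplexed N t ?G' $$ (k, j) else 0)"
      using f_less[OF i] by simp
    also have "\<dots> = (\<Sum>k\<in>{0..<2 ^ N}. (if i = f k then \<phi> (bit k) else 0) * multiplexed N t ?G' $$ (k, j))"
      using f_iff[of i] by (intro sum.cong) auto
    also have "\<dots> = (?M * multiplexed N t ?G') $$ (i, j)"
      using i j by (simp add: dims scalar_prod_def)
    finally show "(multiplexed N t G * ?M) $$ (i, j) = (?M * multiplexed N t ?G') $$ (i, j)" .
  qed (simp_all add: multiplexed_def)
  then show ?thesis by (simp only: \<phi>)
qed

lemma merges_circuit_Nil [simp]: "merges_circuit [] = []"
  and merges_circuit_Cons [simp]: "merges_circuit (m # ms) = merge_circuit m @ merges_circuit ms"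
  by (simp_all add: merges_circuit_def)

lemma merges_circuit_valid:
  "\<forall>m\<in>set ms. merge_below n m \<Longrightarrow> n \<le> N \<Longrightarrow> valid_circuit N (merges_circuit ms)"
  by (induction ms) (auto simp: merge_circuit_valid simp del: merge_circuit.simps)

lemma cnot_count_merges: "cnot_count (merges_circuit ms) = 3 * length ms"
proof (induction ms)
  case (Cons m ms)
  then show ?case by (cases m) simp
qed simp

lemma independent_of_merges:
  assumes "\<forall>m\<in>set ms. merge_below n m" "independent_of t G" "n \<le> t"
  shows "independent_of t (\<lambda>y. G (merges_bits ms y))"
proof -
  have "merges_bits ms (y(t := b)) = (merges_bits ms y)(t := b)" for y b
    using assms(1)
  proof (induction ms arbitrary: y)
    case (Cons m ms)
    obtain u v w where "m = (u, v, w)" by (cases m)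
    then have "merge_bits m (y(t := b)) = (merge_bits m y)(t := b)"
      using Cons.prems \<open>n \<le> t\<close> by (auto simp: fun_upd_twist)
    then show ?case using Cons by (simp only: merges_bits.simps list.set insert_iff) blast
  qed simp
  then show ?thesis using assms(2) by (simp add: independent_of_def)
qed

lemma conjugate_multiplexed_merges:
  assumes "\<forall>m\<in>set ms. merge_below n m" "independent_of t G" "n \<le> t" "t < N"
  shows "multiplexed N t G * circuit_mat N (merges_circuit ms) =
    circuit_mat N (merges_circuit ms) * multiplexed N t (\<lambda>y. G (merges_bits ms y))"
  using assms(1)
proof (induction ms)
  case Nil
  show ?case
    by (simp add: left_mult_one_mat[OF multiplexed_carrier] right_mult_one_mat[OF multiplexed_carrier])
next
  case (Cons m ms)
  let ?n = "2 ^ N"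
  obtain u v w where m: "m = (u, v, w)" by (cases m)
  let ?A = "circuit_mat N (merges_circuit ms)" and ?B = "circuit_mat N (merge_circuit m)"
  let ?P = "\<lambda>G. multiplexed N t G"
  have c: "?A \<in> carrier_mat ?n ?n" "?B \<in> carrier_mat ?n ?n" "?P G \<in> carrier_mat ?n ?n" for G
    by simp_all
  have "?P G * circuit_mat N (merges_circuit (m # ms)) = (?P G * ?A) * ?B"
    by (simp add: circuit_mat_append assoc_mult_mat[OF c(3,1,2)])
  also have "\<dots> = ?A * (?P (\<lambda>y. G (merges_bits ms y)) * ?B)"
    using Cons by (simp add: assoc_mult_mat[OF c(1,3,2)])
  also have "?P (\<lambda>y. G (merges_bits ms y)) * ?B = ?B * ?P (\<lambda>y. G (merges_bits (m # ms) y))"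
    using conjugate_multiplexed_merge[of N u v w t "\<lambda>y. G (merges_bits ms y)"]
      independent_of_merges[of ms n t G] Cons.prems assms m
    by (auto simp del: merge_bits.simps merge_circuit.simps)
  finally show ?case
    by (simp add: circuit_mat_append assoc_mult_mat[OF c(1,2,3)])
qed

text \<open>Moving the merges across the middle part composes \<open>G\<close> with their classical
  action; merges and inverse then meet and cancel, phases included.\<close>

lemma circuit_mat_conjugate_merges:
  assumes "\<forall>m\<in>set ms. merge_below n m" "n \<le> t" "t < N"
    and "circuit_mat N P = multiplexed N t G" "independent_of t G"
  shows "circuit_mat N (merges_circuit ms @ P @ circuit_inverse (merges_circuit ms)) =
    multiplexed N t (\<lambda>y. G (merges_bits ms y))"
proof -
  let ?n = "2 ^ N"
  let ?U = "circuit_mat N (merges_circuit ms)"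
  let ?V = "circuit_mat N (circuit_inverse (merges_circuit ms))"
  let ?P = "\<lambda>G. multiplexed N t G"
  have c: "?U \<in> carrier_mat ?n ?n" "?V \<in> carrier_mat ?n ?n" "?P G \<in> carrier_mat ?n ?n" for G
    by simp_all
  have "circuit_mat N (merges_circuit ms @ P @ circuit_inverse (merges_circuit ms)) = ?V * (?P G * ?U)"
    using assms(4) by (simp add: circuit_mat_append assoc_mult_mat[OF c(2,3,1)])
  also have "\<dots> = (?V * ?U) * ?P (\<lambda>y. G (merges_bits ms y))"
    using conjugate_multiplexed_merges[OF assms(1,5,2,3)] by (simp add: assoc_mult_mat[OF c(2,1,3)])
  also have "?V * ?U = 1\<^sub>m ?n"
    using assms by (intro circuit_mat_inverse merges_circuit_valid) auto
  finally show ?thesis by (simp add: left_mult_one_mat[OF multiplexed_carrier])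
qed

subsection \<open>Recognizing relative-phase Toffoli gates\<close>

text \<open>Such an operator has its nonzero entries exactly where \<open>toffoli_mat n\<close> has
  its ones. These entries have modulus 1 and, collected by rows, form the diagonal of
  \<open>D\<close>.\<close>

lemma relative_phase_toffoliI:
  assumes U: "U = multiplexed (n + 1) n K"
    and all: "\<And>y. \<forall>k<n. y k \<Longrightarrow> \<exists>a b. K y = mat2 0 a b 0 \<and> cmod a = 1 \<and> cmod b = 1"
    and other: "\<And>y. \<not> (\<forall>k<n. y k) \<Longrightarrow> \<exists>a b. K y = mat2 a 0 0 b \<and> cmod a = 1 \<and> cmod b = 1"
  shows "relative_phase_toffoli n U"
proof -
  let ?n = "2 ^ (n + 1)"
  define f where "f j = (if \<forall>k<n. bit j k then flip_bit n j else j)" for j :: nat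
  \<comment> \<open>Row \<open>i\<close> has its only nonzero entry in column \<open>f i\<close>,
    because \<open>f\<close> is an involution.\<close>
  define d where "d i = U $$ (i, f i)" for i
  define D where "D = mat ?n ?n (\<lambda>(i, j). if i = j then d i else 0)"
  have f_less: "f j < ?n" if "j < ?n" for j
    using that flip_bit_less[of j "n + 1" n] by (simp add: f_def)
  have f_f: "f (f j) = j" for j by (auto simp: f_def)
  have f_iff: "i = f j \<longleftrightarrow> j = f i" for i j using f_f by metis
  have U_entry: "U $$ (i, j) = (if i = f j then d i else 0) \<and> (i = f j \<longrightarrow> cmod (d i) = 1)"
    if i: "i < ?n" and j: "j < ?n" for i j
  proof -
    have "i = f j \<longleftrightarrow> (\<forall>k<n + 1. k \<noteq> n \<longrightarrow> bit i k = bit j k) \<and> bit i n = bit (f j) n"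
      using agree_off_cases[OF i j, of n] by (auto simp: f_def split: if_splits)
    then have "U $$ (i, j) = (if i = f j then U $$ (i, j) else 0) \<and>
        (i = f j \<longrightarrow> cmod (U $$ (i, j)) = 1)"
      using all[of "bit j"] other[of "bit j"] i j
      by (auto simp: U multiplexed_def f_def split: if_splits)
    moreover have "i = f j \<Longrightarrow> U $$ (i, j) = d i" using f_iff[of i j] by (simp add: d_def)
    ultimately show ?thesis by auto
  qed
  have d: "cmod (d i) = 1" if "i < ?n" for i
    using U_entry[OF that f_less[OF that]] f_f by auto
  have D: "D \<in> carrier_mat ?n ?n" by (simp add: D_def)
  have adj: "mat_adjoint D = mat ?n ?n (\<lambda>(i, j). if i = j then cnj (d i) else 0)"
    by (rule eq_matI) (auto simp: D_def mat_adjoint_def mat_of_rows_def cols_def)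
  have dd: "d i * cnj (d i) = 1" "cnj (d i) * d i = 1" if "i < ?n" for i
    using d[OF that] complex_norm_square[of "d i"] by (simp_all add: mult.commute)
  have "unitary_mat ?n D"
    unfolding unitary_mat_def adj
    by (auto simp: D_def scalar_prod_def if_distrib dd sum.delta intro!: eq_matI cong: if_cong)
  moreover have "diagonal_mat D" by (simp add: diagonal_mat_def D_def)
  moreover have "U = D * toffoli_mat n"
  proof (rule eq_matI)
    fix i j assume "i < dim_row (D * toffoli_mat n)" "j < dim_col (D * toffoli_mat n)"
    then have i: "i < ?n" and j: "j < ?n" by (simp_all add: D_def toffoli_mat_def)
    have "(D * toffoli_mat n) $$ (i, j) =
        (\<Sum>k\<in>{0..<?n}. if k = i then d i * of_bool (i = f j) else 0)"
      using i j by (auto simp: D_def toffoli_mat_def scalar_prod_def f_def intro!: sum.cong)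
    then show "U $$ (i, j) = (D * toffoli_mat n) $$ (i, j)"
      using U_entry[OF i j] i by simp
  qed (simp_all add: D_def toffoli_mat_def U multiplexed_def)
  ultimately show ?thesis unfolding relative_phase_toffoli_def by blast
qed

subsection \<open>Depth\<close>

text \<open>An upper bound on the depth that composes without reasoning about the least number in
  \<open>depth\<close>.\<close>

definition has_depth :: "circuit \<Rightarrow> nat \<Rightarrow> bool" where
  "has_depth c d \<longleftrightarrow> (\<exists>L. layering c d L)"

lemma has_depth_length: "length c \<le> d \<Longrightarrow> has_depth c d"
  unfolding has_depth_def using layering_exists[of c] by (force simp: layering_def)

lemma depth_le_of_has_depth: "has_depth c d \<Longrightarrow> depth c \<le> d"
  by (auto simp: has_depth_def intro: depth_le)

lemma has_depth_append:
  assumes "has_depth a d" "has_depth b e"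
  shows "has_depth (a @ b) (d + e)"
proof -
  obtain L M where L: "layering a d L" and M: "layering b e M"
    using assms by (auto simp: has_depth_def)
  have "layering (a @ b) (d + e) (\<lambda>i. if i < length a then L i else d + M (i - length a))"
    unfolding layering_def
  proof (intro conjI allI impI)
    fix i assume "i < length (a @ b)"
    then show "(if i < length a then L i else d + M (i - length a)) < d + e"
      using L M by (auto simp: layering_def intro: trans_less_add1)
  next
    fix j i
    assume "j < length (a @ b)" "i < j" "gate_qubits ((a @ b) ! i) \<inter> gate_qubits ((a @ b) ! j) \<noteq> {}"
    then show "(if i < length a then L i else d + M (i - length a)) <
        (if j < length a then L j else d + M (j - length a))"
      using L M by (auto simp: layering_def nth_append intro: trans_less_add1 split: if_splits)
  qed
  then show ?thesis unfolding has_depth_def by blast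
qed

text \<open>Gates without a common qubit do not constrain each other, so the two layerings are
  overlaid instead of stacked.\<close>

lemma has_depth_append_disjoint:
  assumes "has_depth a d" "has_depth b d"
    and disj: "\<And>g h. g \<in> set a \<Longrightarrow> h \<in> set b \<Longrightarrow> gate_qubits g \<inter> gate_qubits h = {}"
  shows "has_depth (a @ b) d"
proof -
  obtain L M where L: "layering a d L" and M: "layering b d M"
    using assms by (auto simp: has_depth_def)
  have "layering (a @ b) d (\<lambda>i. if i < length a then L i else M (i - length a))"
    unfolding layering_def
  proof (intro conjI allI impI)
    fix i assume "i < length (a @ b)"
    then show "(if i < length a then L i else M (i - length a)) < d"
      using L M by (auto simp: layering_def)
  next
    fix j i
    assume j: "j < length (a @ b)" and "i < j"
      and meet: "gate_qubits ((a @ b) ! i) \<inter> gate_qubits ((a @ b) ! j) \<noteq> {}"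
    have "\<not> (i < length a \<and> length a \<le> j)"
    proof
      assume "i < length a \<and> length a \<le> j"
      then have "(a @ b) ! i \<in> set a" "(a @ b) ! j \<in> set b" using j by (auto simp: nth_append)
      then show False using disj meet by blast
    qed
    then show "(if i < length a then L i else M (i - length a)) <
        (if j < length a then L j else M (j - length a))"
      using L M j \<open>i < j\<close> meet by (auto simp: layering_def nth_append split: if_splits)
  qed
  then show ?thesis unfolding has_depth_def by blast
qed

lemma has_depth_inverse:
  assumes "has_depth c d" shows "has_depth (circuit_inverse c) d"
proof -
  have q: "gate_qubits (gate_inverse g) = gate_qubits g" for g by (cases g) auto
  obtain L where L: "layering c d L" using assms by (auto simp: has_depth_def)
  let ?l = "length c"
  have nth: "gate_qubits (circuit_inverse c ! i) = gate_qubits (c ! (?l - Suc i))" if "i < ?l" for i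
    using that by (simp add: circuit_inverse_def rev_nth q)
  \<comment> \<open>The reversed order of the gates is matched by counting the layers from the
    end.\<close>
  have "layering (circuit_inverse c) d (\<lambda>i. d - Suc (L (?l - Suc i)))"
    unfolding layering_def
  proof (intro conjI allI impI)
    fix i assume "i < length (circuit_inverse c)"
    then have "?l - Suc i < ?l" by (simp add: circuit_inverse_def)
    then have "L (?l - Suc i) < d" using L by (auto simp: layering_def)
    then show "d - Suc (L (?l - Suc i)) < d" by simp
  next
    fix j i
    assume "j < length (circuit_inverse c)" and ij: "i < j"
      and meet: "gate_qubits (circuit_inverse c ! i) \<inter> gate_qubits (circuit_inverse c ! j) \<noteq> {}"
    then have j: "j < ?l" by (simp add: circuit_inverse_def)
    have "?l - Suc i < ?l" "?l - Suc j < ?l - Suc i" using ij j by auto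
    moreover have "gate_qubits (c ! (?l - Suc j)) \<inter> gate_qubits (c ! (?l - Suc i)) \<noteq> {}"
      using meet nth[of i] nth[of j] ij j by (simp add: Int_commute)
    ultimately have "L (?l - Suc j) < L (?l - Suc i)" "L (?l - Suc i) < d"
      using L unfolding layering_def by blast+
    then show "d - Suc (L (?l - Suc i)) < d - Suc (L (?l - Suc j))" by simp
  qed
  then show ?thesis unfolding has_depth_def by blast
qed

fun merge_qubits :: "nat \<times> nat \<times> nat \<Rightarrow> nat set" where
  "merge_qubits (u, v, w) = {u, v, w}"

subsection \<open>Merging with conditionally clean qubits\<close>

text \<open>A qubit of role \<open>Value i\<close> still has to be tested; one of role \<open>Clean i\<close> is known to hold 1
  provided that all values of rank at most \<open>i\<close> do. The target of a merge must have a smaller rank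
  than its operands, which would otherwise vouch for its cleanness themselves.\<close>

datatype role = Value nat | Clean nat

text \<open>Once \<open>w\<close> was clean, its new value of rank \<open>i\<close> implies both
  operands, which therefore become \<open>Clean i\<close>. The merged value takes the lower rank, so
  \<open>v\<close> gets rank \<open>i\<close> as well.\<close>

inductive merging :: "nat \<Rightarrow> (nat \<Rightarrow> role) \<Rightarrow> (nat \<times> nat \<times> nat) list \<Rightarrow> (nat \<Rightarrow> role) \<Rightarrow> bool"
  for n where
  Nil: "merging n \<sigma> [] \<sigma>"
| Cons: "merge_below n (u, v, w) \<Longrightarrow> \<sigma> u = Value i \<Longrightarrow> \<sigma> v = Value j \<Longrightarrow> \<sigma> w = Clean k \<Longrightarrow>
    k < i \<Longrightarrow> i \<le> j \<Longrightarrow> merging n (\<sigma>(u := Clean i, v := Clean i, w := Value i)) ms \<sigma>' \<Longrightarrow>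
    merging n \<sigma> ((u, v, w) # ms) \<sigma>'"

definition values_set :: "nat \<Rightarrow> (nat \<Rightarrow> role) \<Rightarrow> (nat \<Rightarrow> bool) \<Rightarrow> bool" where
  "values_set n \<sigma> y \<longleftrightarrow> (\<forall>q<n. \<forall>i. \<sigma> q = Value i \<longrightarrow> y q)"

text \<open>Treating every rank \<open>r\<close> separately ensures that a clean qubit relies on
  values of its own or lower rank only; this is what the target of a merge needs.\<close>

definition clean_sound :: "nat \<Rightarrow> (nat \<Rightarrow> role) \<Rightarrow> (nat \<Rightarrow> bool) \<Rightarrow> bool" where
  "clean_sound n \<sigma> y \<longleftrightarrow> (\<forall>r. (\<forall>q<n. \<forall>i\<le>r. \<sigma> q = Value i \<longrightarrow> y q) \<longrightarrow>
     (\<forall>q<n. \<forall>i\<le>r. \<sigma> q = Clean i \<longrightarrow> y q))"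

lemma merging_append:
  "merging n \<sigma> ms \<sigma>' \<Longrightarrow> merging n \<sigma>' ms' \<sigma>'' \<Longrightarrow> merging n \<sigma> (ms @ ms') \<sigma>''"
  by (induction rule: merging.induct) (auto intro: merging.intros)

lemma merging_below: "merging n \<sigma> ms \<sigma>' \<Longrightarrow> m \<in> set ms \<Longrightarrow> merge_below n m"
  by (induction rule: merging.induct) auto

text \<open>If all values of rank below \<open>i\<close> are set, \<open>w\<close> holds 1 and
  receives the conjunction of \<open>u\<close> and \<open>v\<close>. Otherwise a value that is 0
  survives the merge untouched, and \<open>values_set\<close> fails before and after.\<close>

lemma merge_bits_sound:
  assumes "merge_below n (u, v, w)" and \<sigma>: "\<sigma> u = Value i" "\<sigma> v = Value j" "\<sigma> w = Clean k"
    and "k < i" "i \<le> j" and sound: "clean_sound n \<sigma> y"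
  defines "\<sigma>' \<equiv> \<sigma>(u := Clean i, v := Clean i, w := Value i)"
  defines "y' \<equiv> merge_bits (u, v, w) y"
  shows "clean_sound n \<sigma>' y'" and "values_set n \<sigma>' y' \<longleftrightarrow> values_set n \<sigma> y"
proof -
  have uvw: "u < n" "v < n" "w < n" "u \<noteq> v" "u \<noteq> w" "v \<noteq> w" using assms(1) by auto
  have other: "\<sigma>' q = \<sigma> q" "y' q = y q" if "q \<noteq> u" "q \<noteq> v" "q \<noteq> w" for q
    using that by (auto simp: \<sigma>'_def y'_def)
  have yw: "y w" if "\<forall>q<n. \<forall>l<i. \<sigma> q = Value l \<longrightarrow> y q"
  proof -
    have "\<forall>q<n. \<forall>l\<le>k. \<sigma> q = Value l \<longrightarrow> y q" using that \<open>k < i\<close> by auto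
    then show ?thesis using sound \<sigma>(3) uvw unfolding clean_sound_def by blast
  qed
  have old_low: "\<forall>q<n. \<forall>l<i. \<sigma> q = Value l \<longrightarrow> y q"
    if r: "\<forall>q<n. \<forall>l\<le>r. \<sigma>' q = Value l \<longrightarrow> y' q" and "i \<le> r \<or> (\<forall>q<n. \<forall>l<i. l \<le> r)" for r
  proof (intro allI impI)
    fix q l assume q: "q < n" "l < i" "\<sigma> q = Value l"
    then have "q \<noteq> u" "q \<noteq> v" "q \<noteq> w" using \<sigma> \<open>i \<le> j\<close> by auto
    moreover have "l \<le> r" using that(2) q by auto
    ultimately show "y q" using r q other by metis
  qed
  \<comment> \<open>Ranks up to \<open>r\<close> include the new value in \<open>w\<close>; since
    \<open>w\<close> held 1 before, that value reveals both operands.\<close>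
  have key: "y u \<and> y v" if r: "\<forall>q<n. \<forall>l\<le>r. \<sigma>' q = Value l \<longrightarrow> y' q" and "i \<le> r" for r
  proof -
    have "y w" using yw old_low[OF r] that(2) by blast
    moreover have "y' w" using r that(2) uvw by (simp add: \<sigma>'_def)
    ultimately show ?thesis by (simp add: y'_def)
  qed
  have old: "\<forall>q<n. \<forall>l\<le>r. \<sigma> q = Value l \<longrightarrow> y q"
    if r: "\<forall>q<n. \<forall>l\<le>r. \<sigma>' q = Value l \<longrightarrow> y' q" for r
  proof (intro allI impI)
    fix q l assume q: "q < n" "l \<le> r" "\<sigma> q = Value l"
    show "y q"
    proof (cases "q = u \<or> q = v")
      case True
      then have "i \<le> r" using q \<sigma> \<open>i \<le> j\<close> by auto
      then show ?thesis using key[OF r] True by auto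
    next
      case False
      moreover have "q \<noteq> w" using q \<sigma> by auto
      ultimately show ?thesis using r q other by metis
    qed
  qed
  show "clean_sound n \<sigma>' y'"
    unfolding clean_sound_def
  proof (intro allI impI)
    fix r q l
    assume r: "\<forall>q<n. \<forall>i\<le>r. \<sigma>' q = Value i \<longrightarrow> y' q" and q: "q < n" "l \<le> r" "\<sigma>' q = Clean l"
    then have "q \<noteq> w" by (auto simp: \<sigma>'_def)
    show "y' q"
    proof (cases "q = u \<or> q = v")
      case True
      then have "l = i" using q \<open>q \<noteq> w\<close> by (auto simp: \<sigma>'_def split: if_splits)
      then show ?thesis using key[OF r] q True uvw by (auto simp: y'_def)
    next
      case False
      then have "\<sigma> q = Clean l" using other \<open>q \<noteq> w\<close> q by metis
      then have "y q" using old[OF r] sound q unfolding clean_sound_def by blast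
      then show ?thesis using other False \<open>q \<noteq> w\<close> by metis
    qed
  qed
  show "values_set n \<sigma>' y' \<longleftrightarrow> values_set n \<sigma> y"
  proof
    assume "values_set n \<sigma>' y'"
    then show "values_set n \<sigma> y" using old unfolding values_set_def by blast
  next
    assume *: "values_set n \<sigma> y"
    then have "y w" "y u" "y v" using yw uvw \<sigma> unfolding values_set_def by blast+
    then show "values_set n \<sigma>' y'"
      using * uvw unfolding values_set_def \<sigma>'_def y'_def by auto
  qed
qed

lemma merging_sound:
  assumes "merging n \<sigma> ms \<sigma>'" "clean_sound n \<sigma> y"
  shows "clean_sound n \<sigma>' (merges_bits ms y) \<and>
    (values_set n \<sigma>' (merges_bits ms y) \<longleftrightarrow> values_set n \<sigma> y)"
  using assms
proof (induction arbitrary: y rule: merging.induct)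
  case (Cons u v w \<sigma> i j k ms \<sigma>')
  note step = merge_bits_sound[OF Cons.hyps(1-6) Cons.prems]
  show ?case using Cons.IH[OF step(1)] step(2) by (simp only: merges_bits.simps)
qed simp

section \<open>Counting qubits by role, and rounds of disjoint merges\<close>

definition role_count :: "nat \<Rightarrow> (nat \<Rightarrow> role) \<Rightarrow> role \<Rightarrow> nat" where
  "role_count n \<sigma> r = card {q. q < n \<and> \<sigma> q = r}"

text \<open>A merge turns two values into clean qubits and one clean qubit into a value. This ties
  the length of \<open>ms\<close>, and with it the CNOT count, to the number of values.\<close>

lemma merging_card_values:
  assumes "merging n \<sigma> ms \<sigma>'"
  shows "card {q. q < n \<and> (\<exists>i. \<sigma>' q = Value i)} + length ms = card {q. q < n \<and> (\<exists>i. \<sigma> q = Value i)}"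
  using assms
proof (induction rule: merging.induct)
  case (Cons u v w \<sigma> i j k ms \<sigma>')
  let ?\<tau> = "\<sigma>(u := Clean i, v := Clean i, w := Value i)"
  let ?V = "{q. q < n \<and> (\<exists>i. \<sigma> q = Value i)}"
  have "{q. q < n \<and> (\<exists>i. ?\<tau> q = Value i)} = insert w (?V - {u, v})"
    using Cons.hyps by auto
  moreover have "w \<notin> ?V" "{u, v} \<subseteq> ?V" "card {u, v} = 2" "finite ?V"
    using Cons.hyps by auto
  ultimately have "card {q. q < n \<and> (\<exists>i. ?\<tau> q = Value i)} = Suc (card ?V - 2)" "2 \<le> card ?V"
    using card_Diff_subset[of "{u, v}" ?V] card_mono[of ?V "{u, v}"] by auto
  then show ?case using Cons.IH by simp
qed simp

primrec parallel :: "(nat \<times> nat \<times> nat) list \<Rightarrow> bool" where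
  "parallel [] \<longleftrightarrow> True"
| "parallel (m # ms) \<longleftrightarrow> (\<forall>m'\<in>set ms. merge_qubits m \<inter> merge_qubits m' = {}) \<and> parallel ms"

text \<open>Empty rounds are allowed, so \<open>d\<close> is an upper bound on the rounds in
  use.\<close>

inductive rounds :: "(nat \<times> nat \<times> nat) list \<Rightarrow> nat \<Rightarrow> bool" where
  Nil: "rounds [] 0"
| append: "rounds ms d \<Longrightarrow> parallel ms' \<Longrightarrow> rounds (ms @ ms') (Suc d)"

lemma rounds_append: "rounds ms' e \<Longrightarrow> rounds ms d \<Longrightarrow> rounds (ms @ ms') (d + e)"
proof (induction rule: rounds.induct)
  case (append ms'' e ms')
  then show ?case using rounds.append[of "ms @ ms''" "d + e" ms'] by simp
qed simp

lemma role_count_upd: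
  assumes "q < n"
  shows "role_count n (\<sigma>(q := r)) s + (if \<sigma> q = s then 1 else 0) =
    role_count n \<sigma> s + (if r = s then 1 else 0)"
proof -
  define S where "S = {p. p < n \<and> \<sigma> p = s}"
  have S: "finite S" "q \<in> S \<longleftrightarrow> \<sigma> q = s" using assms by (auto simp: S_def)
  have "{p. p < n \<and> (\<sigma>(q := r)) p = s} = (if r = s then insert q (S - {q}) else S - {q})"
  proof (rule Set.set_eqI)
    fix p
    show "p \<in> {p. p < n \<and> (\<sigma>(q := r)) p = s} \<longleftrightarrow>
        p \<in> (if r = s then insert q (S - {q}) else S - {q})"
      using assms by (cases "p = q") (simp_all add: S_def)
  qed
  moreover have "card S = card (S - {q}) + (if \<sigma> q = s then 1 else 0)"
  proof (cases "q \<in> S")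
    case True
    then show ?thesis using card_Suc_Diff1[OF S(1) True] S(2) by simp
  next
    case False
    then show ?thesis using S(2) by simp
  qed
  moreover have "card (insert q (S - {q})) = Suc (card (S - {q}))"
    using S(1) by (intro card_insert_disjoint) auto
  ultimately show ?thesis
    unfolding role_count_def S_def[symmetric] by (simp del: card_insert_disjoint insert_Diff_single)
qed

text \<open>\<open>u\<close> loses and \<open>w\<close> gains \<open>Value i\<close>, so the only
  net loss among values is at rank \<open>j\<close>. The equations are additive because subtraction
  on \<open>nat\<close> truncates.\<close>

lemma role_count_merge:
  assumes "merge_below n (u, v, w)" "\<sigma> u = Value i" "\<sigma> v = Value j" "\<sigma> w = Clean k"
  defines "\<sigma>' \<equiv> \<sigma>(u := Clean i, v := Clean i, w := Value i)"
  shows "role_count n \<sigma>' (Value l) + (if l = j then 1 else 0) = role_count n \<sigma> (Value l)"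
    and "role_count n \<sigma>' (Clean l) + (if l = k then 1 else 0) =
      role_count n \<sigma> (Clean l) + (if l = i then 2 else 0)"
proof -
  let ?\<sigma>\<^sub>1 = "\<sigma>(u := Clean i)" and ?\<sigma>\<^sub>2 = "\<sigma>(u := Clean i, v := Clean i)"
  have uvw: "u < n" "v < n" "w < n" "?\<sigma>\<^sub>1 v = Value j" "?\<sigma>\<^sub>2 w = Clean k"
    using assms(1-4) by auto
  note step = role_count_upd[OF uvw(1), of \<sigma> "Clean i", unfolded assms(2)]
    role_count_upd[OF uvw(2), of ?\<sigma>\<^sub>1 "Clean i", unfolded uvw(4)]
    role_count_upd[OF uvw(3), of ?\<sigma>\<^sub>2 "Value i", unfolded uvw(5), folded \<sigma>'_def]
  show "role_count n \<sigma>' (Value l) + (if l = j then 1 else 0) = role_count n \<sigma> (Value l)"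
    using step[of "Value l"] by (simp split: if_splits)
  show "role_count n \<sigma>' (Clean l) + (if l = k then 1 else 0) =
      role_count n \<sigma> (Clean l) + (if l = i then 2 else 0)"
    using step[of "Clean l"] by (simp split: if_splits)
qed

text \<open>\<open>ls\<close> lists the ranks of the planned merges, and \<open>A\<close> holds the
  qubits already taken. A merge of rank \<open>Suc j\<close> takes two \<open>Value (Suc j)\<close>
  and one \<open>Clean j\<close> outside \<open>A\<close>; choosing greedily and adding the choice
  to \<open>A\<close> keeps the merges disjoint.\<close>

lemma parallel_merging_exists:
  assumes "0 \<notin> set ls"
    and "\<And>j. 2 * count_list ls j \<le> card {q. q < n \<and> q \<notin> A \<and> \<sigma> q = Value j}"
    and "\<And>j. count_list ls (Suc j) \<le> card {q. q < n \<and> q \<notin> A \<and> \<sigma> q = Clean j}"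
  shows "\<exists>ms \<sigma>'. merging n \<sigma> ms \<sigma>' \<and> parallel ms \<and> (\<forall>m\<in>set ms. merge_qubits m \<inter> A = {}) \<and>
    (\<forall>j. role_count n \<sigma>' (Value j) + count_list ls j = role_count n \<sigma> (Value j)) \<and>
    (\<forall>j. role_count n \<sigma>' (Clean j) + count_list ls (Suc j) =
       role_count n \<sigma> (Clean j) + 2 * count_list ls j)"
  using assms
proof (induction ls arbitrary: A \<sigma>)
  case Nil
  show ?case by (rule exI[of _ "[]"]) (auto intro: merging.Nil)
next
  case (Cons i ls)
  define S where "S r = {q. q < n \<and> q \<notin> A \<and> \<sigma> q = r}" for r
  have VS: "2 * count_list (i # ls) j \<le> card (S (Value j))" for j
    using Cons.prems(2) by (simp only: S_def)
  have CS: "count_list (i # ls) (Suc j) \<le> card (S (Clean j))" for j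
    using Cons.prems(3) by (simp only: S_def)
  obtain k where i: "i = Suc k" using Cons.prems(1) by (cases i) auto
  have "2 \<le> card (S (Value i))" using VS[of i] by simp
  then obtain T where "T \<subseteq> S (Value i)" "card T = 2" by (rule obtain_subset_with_card_n)
  then obtain u v where uv: "u \<in> S (Value i)" "v \<in> S (Value i)" "u \<noteq> v"
    by (auto simp: card_2_iff)
  have "1 \<le> card (S (Clean k))" using CS[of k] i by simp
  then obtain w where w: "w \<in> S (Clean k)" by (metis card.empty ex_in_conv not_one_le_zero)
  let ?\<sigma> = "\<sigma>(u := Clean i, v := Clean i, w := Value i)"
  let ?A = "A \<union> {u, v, w}"
  have m: "merge_below n (u, v, w)" "\<sigma> u = Value i" "\<sigma> v = Value i" "\<sigma> w = Clean k"
    using uv w by (auto simp: S_def)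
  \<comment> \<open>Roles change only on the qubits just excluded, so freshly freed qubits are not
    reused within the round.\<close>
  have S': "{q. q < n \<and> q \<notin> ?A \<and> ?\<sigma> q = r} = S r - {u, v, w}" for r
    using m by (auto simp: S_def)
  have V': "2 * count_list ls j \<le> card (S (Value j) - {u, v, w})" for j
  proof (cases "j = i")
    case True
    have "card (S (Value i) - {u, v, w}) = card (S (Value i) - {u, v})"
      using w by (intro arg_cong[of _ _ card]) (auto simp: S_def)
    also have "\<dots> = card (S (Value i)) - 2"
      using uv by (subst card_Diff_subset) auto
    finally show ?thesis using VS[of i] True by simp
  next
    case False
    then have "S (Value j) - {u, v, w} = S (Value j)" using uv w by (auto simp: S_def)
    then show ?thesis using VS[of j] False by simp
  qed
  have C': "count_list ls (Suc j) \<le> card (S (Clean j) - {u, v, w})" for j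
  proof (cases "j = k")
    case True
    have "card (S (Clean k) - {u, v, w}) = card (S (Clean k) - {w})"
      using uv by (intro arg_cong[of _ _ card]) (auto simp: S_def)
    also have "\<dots> = card (S (Clean k)) - 1"
      using w by (subst card_Diff_subset) auto
    finally show ?thesis using CS[of k] True i by simp
  next
    case False
    then have "S (Clean j) - {u, v, w} = S (Clean j)" using uv w by (auto simp: S_def)
    then show ?thesis using CS[of j] False i by simp
  qed
  have "0 \<notin> set ls" using Cons.prems(1) by simp
  from Cons.IH[OF this, of ?A ?\<sigma>, unfolded S', OF V' C']
  obtain ms \<sigma>' where IH: "merging n ?\<sigma> ms \<sigma>'" "parallel ms" "\<forall>m\<in>set ms. merge_qubits m \<inter> ?A = {}"
    "\<forall>j. role_count n \<sigma>' (Value j) + count_list ls j = role_count n ?\<sigma> (Value j)"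
    "\<forall>j. role_count n \<sigma>' (Clean j) + count_list ls (Suc j) =
       role_count n ?\<sigma> (Clean j) + 2 * count_list ls j"
    by blast
  have "merging n \<sigma> ((u, v, w) # ms) \<sigma>'"
    by (rule merging.Cons[OF m]) (use i IH in auto)
  moreover have "parallel ((u, v, w) # ms)" using IH(2,3) by auto
  moreover have "\<forall>m\<in>set ((u, v, w) # ms). merge_qubits m \<inter> A = {}"
    using IH(3) uv w by (auto simp: S_def)
  moreover have "role_count n \<sigma>' (Value j) + count_list (i # ls) j = role_count n \<sigma> (Value j)" for j
    using IH(4)[rule_format, of j] role_count_merge(1)[OF m, of j] by auto
  moreover have "role_count n \<sigma>' (Clean j) + count_list (i # ls) (Suc j) =
       role_count n \<sigma> (Clean j) + 2 * count_list (i # ls) j" for j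
    using IH(5)[rule_format, of j] role_count_merge(2)[OF m, of j] i by auto
  ultimately show ?case by blast
qed

section \<open>Scheduling the merges level by level\<close>

lemma count_list_exists:
  "\<exists>ls. \<forall>j. count_list ls j = (if 1 \<le> j \<and> j \<le> J then f j else (0::nat))"
  for f :: "nat \<Rightarrow> nat"
proof (induction J)
  case 0
  show ?case by (rule exI[of _ "[]"]) auto
next
  case (Suc J)
  then obtain ls where ls: "\<forall>j. count_list ls j = (if 1 \<le> j \<and> j \<le> J then f j else 0)" by blast
  have rep: "count_list (replicate k x) j = (if j = x then k else 0)" for k x j :: nat
    by (induction k) auto
  show ?case
    by (rule exI[of _ "ls @ replicate (f (Suc J)) (Suc J)"]) (use ls rep in auto)
qed

text \<open>The number of values left on a level of size \<open>s\<close> after \<open>k\<close>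
  rounds of pairing, an odd one waiting for the next round.\<close>

primrec halve :: "nat \<Rightarrow> nat \<Rightarrow> nat" where
  "halve s 0 = s"
| "halve s (Suc k) = (halve s k + 1) div 2"

lemma halve_le: "halve s k \<le> s"
  by (induction k) auto

lemma halve_zero [simp]: "halve 0 k = 0"
  by (induction k) auto

lemma halve_pos: "1 \<le> s \<Longrightarrow> 1 \<le> halve s k"
  by (induction k) auto

lemma halve_le_of_le: "s \<le> a * 2 ^ k \<Longrightarrow> halve s k \<le> a"
proof (induction k arbitrary: a)
  case (Suc k)
  then have "s \<le> (2 * a) * 2 ^ k" by (simp add: ac_simps)
  from Suc.IH[OF this] show ?case by simp
qed simp

text \<open>Let \<open>s\<close> and \<open>s'\<close> be the sizes of two successive levels. Then
  \<open>k\<close> halvings of the first free \<open>2 * (s - halve s k)\<close> operands and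
  \<open>k\<close> halvings of the second use up \<open>s' - halve s' k\<close> targets; supply
  meets demand. In the induction the slack of 2 absorbs the rounding.\<close>

lemma halve_doubling: "s' + 2 \<le> 2 * s \<Longrightarrow> 2 * halve s k + s' \<le> 2 * s + halve s' k"
proof (induction k)
  case (Suc k)
  define p q K where "p = halve s k" and "q = halve s' k" and "K = 2 * s - s'"
  have "2 * p \<le> q + K" "2 \<le> K" using Suc by (auto simp: p_def q_def K_def)
  then have "2 * ((p + 1) div 2) \<le> (q + 1) div 2 + K" by linarith
  then show ?case using Suc.prems by (simp add: p_def q_def K_def)
qed simp

text \<open>Two clean qubits suffice to reduce three values to one, hence \<open>first\<close>;
  \<open>growth\<close> is the hypothesis of \<open>halve_doubling\<close>; \<open>upper\<close>
  lets \<open>Suc j\<close> halvings finish level \<open>j\<close>.\<close>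

locale level_sizes =
  fixes s :: "nat \<Rightarrow> nat" and J :: nat
  assumes first: "s 1 \<le> 3"
    and growth: "\<And>j. 1 \<le> j \<Longrightarrow> s (Suc j) = 0 \<or> s (Suc j) + 2 \<le> 2 * s j"
    and pos: "\<And>j. 1 \<le> j \<Longrightarrow> j \<le> J \<Longrightarrow> 1 \<le> s j"
    and zero: "\<And>j. J < j \<Longrightarrow> s j = 0"
    and upper: "\<And>j. 1 \<le> j \<Longrightarrow> s j \<le> 2 ^ Suc j"
begin

text \<open>Level \<open>j\<close> performs its first halving in round \<open>j\<close>, one round after the level below, so that
  the operands of a level's halving serve as targets of the next level's halving.\<close>

definition after_rounds :: "nat \<Rightarrow> (nat \<Rightarrow> role) \<Rightarrow> nat \<Rightarrow> bool" where
  "after_rounds n \<sigma> \<tau> \<longleftrightarrow>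
     (\<forall>j. role_count n \<sigma> (Value j) = (if j = 0 then 0 else halve (s j) (Suc \<tau> - j))) \<and>
     role_count n \<sigma> (Clean 0) + s 1 = 2 + role_count n \<sigma> (Value 1) \<and>
     (\<forall>j\<ge>1. role_count n \<sigma> (Clean j) + 2 * role_count n \<sigma> (Value j) + s (Suc j) =
        2 * s j + role_count n \<sigma> (Value (Suc j)))"

text \<open>Level \<open>j\<close> performs \<open>h j - h' j\<close> merges in the round. The
  equations on clean qubits in \<open>after_rounds\<close> are a balance: a merge on level
  \<open>j\<close> frees two qubits of rank \<open>j\<close>, and a merge on level
  \<open>Suc j\<close> takes one of them.\<close>

lemma round_exists:
  assumes "after_rounds n \<sigma> \<tau>"
  shows "\<exists>ms \<sigma>'. merging n \<sigma> ms \<sigma>' \<and> parallel ms \<and> after_rounds n \<sigma>' (Suc \<tau>)"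
proof -
  define h where "h j = halve (s j) (Suc \<tau> - j)" for j
  define h' where "h' j = halve (s j) (Suc (Suc \<tau>) - j)" for j
  \<comment> \<open>Truncated subtraction gives exponent 0 to a level that has not started yet, so
    its count stays the same.\<close>
  have h': "h' j = h j \<or> h' j = (h j + 1) div 2" for j
    by (cases "j \<le> Suc \<tau>") (auto simp: h_def h'_def Suc_diff_le)
  have h'_le: "h' j \<le> h j" "2 * (h j - h' j) \<le> h j" for j using h'[of j] by auto
  have V: "role_count n \<sigma> (Value j) = (if j = 0 then 0 else h j)" for j
    using assms by (simp add: after_rounds_def h_def)
  have C0: "role_count n \<sigma> (Clean 0) + s 1 = 2 + h 1"
    using assms V[of 1] by (simp add: after_rounds_def)
  have C: "role_count n \<sigma> (Clean j) + 2 * h j + s (Suc j) = 2 * s j + h (Suc j)" if "1 \<le> j" for j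
  proof -
    have "role_count n \<sigma> (Clean j) + 2 * role_count n \<sigma> (Value j) + s (Suc j) =
        2 * s j + role_count n \<sigma> (Value (Suc j))"
      using assms that unfolding after_rounds_def by blast
    then show ?thesis using that by (simp add: V)
  qed
  have h_zero: "h j - h' j = 0" if "J < j" for j
    using zero[OF that] by (simp add: h_def h'_def)
  obtain ls where ls: "\<forall>j. count_list ls j = (if 1 \<le> j \<and> j \<le> J then h j - h' j else 0)"
    using count_list_exists[of J "\<lambda>j. h j - h' j"] by blast
  then have count: "count_list ls j = (if j = 0 then 0 else h j - h' j)" for j
    using h_zero[of j] by auto
  have "0 \<notin> set ls" using count[of 0] by (simp add: count_list_0_iff)
  moreover have "2 * count_list ls j \<le> card {q. q < n \<and> q \<notin> {} \<and> \<sigma> q = Value j}" for j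
    using h'_le[of j] V[of j] by (simp add: count role_count_def)
  moreover have "count_list ls (Suc j) \<le> card {q. q < n \<and> q \<notin> {} \<and> \<sigma> q = Clean j}" for j
  proof -
    have "h (Suc j) - h' (Suc j) \<le> role_count n \<sigma> (Clean j)"
    proof (cases "j = 0")
      case True
      \<comment> \<open>A nonempty level 1 keeps at least one value, so with \<open>first\<close> it
        never takes more than the two \<open>Clean 0\<close> qubits.\<close>
      have "s 1 = 0 \<or> 1 \<le> h' 1"
        unfolding h'_def using halve_pos[of "s 1" "Suc (Suc \<tau>) - 1"] by linarith
      then have "s 1 \<le> 2 + h' 1" using first by linarith
      then show ?thesis using C0 True by simp
    next
      case False
      \<comment> \<open>Level \<open>Suc j\<close> started one round later, so its count after this
        round and that of level \<open>j\<close> before it have seen equally many halvings.\<close>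
      then have "2 * h j + s (Suc j) \<le> 2 * s j + h' (Suc j)"
        using growth[of j] halve_doubling[of "s (Suc j)" "s j"] halve_le[of "s j"]
        by (auto simp: h_def h'_def)
      then show ?thesis using C[of j] False by simp
    qed
    then show ?thesis by (simp add: count role_count_def)
  qed
  ultimately obtain ms \<sigma>' where ms: "merging n \<sigma> ms \<sigma>'" "parallel ms"
    "\<And>j. role_count n \<sigma>' (Value j) + count_list ls j = role_count n \<sigma> (Value j)"
    "\<And>j. role_count n \<sigma>' (Clean j) + count_list ls (Suc j) =
       role_count n \<sigma> (Clean j) + 2 * count_list ls j"
    using parallel_merging_exists[of ls n "{}" \<sigma>] by blast
  have V': "role_count n \<sigma>' (Value j) = (if j = 0 then 0 else h' j)" for j
    using ms(3)[of j] h'_le[of j] by (auto simp: V count)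
  have "after_rounds n \<sigma>' (Suc \<tau>)"
    unfolding after_rounds_def
  proof (intro conjI allI impI)
    show "role_count n \<sigma>' (Value j) = (if j = 0 then 0 else halve (s j) (Suc (Suc \<tau>) - j))" for j
      using V'[of j] by (simp add: h'_def)
    show "role_count n \<sigma>' (Clean 0) + s 1 = 2 + role_count n \<sigma>' (Value 1)"
      using ms(4)[of 0] C0 h'_le[of 1] by (simp add: V' count)
    show "role_count n \<sigma>' (Clean j) + 2 * role_count n \<sigma>' (Value j) + s (Suc j) =
        2 * s j + role_count n \<sigma>' (Value (Suc j))" if "1 \<le> j" for j
      using ms(4)[of j] C[OF that] h'_le[of j] h'_le[of "Suc j"] that by (simp add: V' count)
  qed
  then show ?thesis using ms(1,2) by blast
qed

lemma rounds_exist: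
  assumes "after_rounds n \<sigma> 0"
  shows "\<exists>ms \<sigma>'. merging n \<sigma> ms \<sigma>' \<and> rounds ms \<tau> \<and> after_rounds n \<sigma>' \<tau>"
proof (induction \<tau>)
  case 0
  show ?case using assms merging.Nil rounds.Nil by blast
next
  case (Suc \<tau>)
  then show ?case using round_exists merging_append rounds.append by metis
qed

text \<open>The two values of highest rank are merged into a clean qubit of the rank just below
  them, one merge per round. The process stops at ranks 1 and 2, whose merge would take a
  \<open>Clean 0\<close> qubit, and none need be left.\<close>

lemma ladder_exists:
  assumes "\<And>j. role_count n \<sigma> (Value j) = (if 1 \<le> j \<and> j \<le> k then 1 else 0)"
    and "\<And>j. 1 \<le> j \<Longrightarrow> j + 2 \<le> k \<Longrightarrow> 1 \<le> role_count n \<sigma> (Clean j)"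
  shows "\<exists>ms \<sigma>'. merging n \<sigma> ms \<sigma>' \<and> rounds ms (k - 2) \<and>
    (\<forall>j. role_count n \<sigma>' (Value j) = (if 1 \<le> j \<and> j \<le> min k 2 then 1 else 0))"
  using assms
proof (induction k arbitrary: \<sigma>)
  case 0
  then show ?case using merging.Nil rounds.Nil by fastforce
next
  case (Suc k)
  show ?case
  proof (cases "k < 2")
    case True
    then show ?thesis using Suc.prems merging.Nil rounds.Nil by fastforce
  next
    case False
    define l where "l = k - 1"
    have k: "k = Suc l" "1 \<le> l" using False by (auto simp: l_def)
    have ex: "\<exists>q<n. \<sigma> q = r" if "1 \<le> role_count n \<sigma> r" for r
      using that by (metis (mono_tags, lifting) card.empty empty_Collect_eq not_one_le_zero role_count_def)
    obtain u v w where q: "u < n" "\<sigma> u = Value k" "v < n" "\<sigma> v = Value (Suc k)" "w < n" "\<sigma> w = Clean l"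
      using ex[of "Value k"] ex[of "Value (Suc k)"] ex[of "Clean l"] Suc.prems k by auto
    let ?\<sigma> = "\<sigma>(u := Clean k, v := Clean k, w := Value k)"
    have m: "merge_below n (u, v, w)" using q by auto
    note count = role_count_merge[where ?\<sigma> = \<sigma>, OF m q(2,4,6)]
    have "\<exists>ms \<sigma>'. merging n ?\<sigma> ms \<sigma>' \<and> rounds ms (k - 2) \<and>
      (\<forall>j. role_count n \<sigma>' (Value j) = (if 1 \<le> j \<and> j \<le> min k 2 then 1 else 0))"
    proof (rule Suc.IH)
      show "role_count n ?\<sigma> (Value j) = (if 1 \<le> j \<and> j \<le> k then 1 else 0)" for j
        using count(1)[of j] Suc.prems(1)[of j] by (auto split: if_splits)
      show "1 \<le> role_count n ?\<sigma> (Clean j)" if "1 \<le> j" "j + 2 \<le> k" for j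
        using count(2)[of j] Suc.prems(2)[of j] that k by (auto split: if_splits)
    qed
    then obtain ms \<sigma>' where ms: "merging n ?\<sigma> ms \<sigma>'" "rounds ms (k - 2)"
      "\<forall>j. role_count n \<sigma>' (Value j) = (if 1 \<le> j \<and> j \<le> min k 2 then 1 else 0)" by blast
    have "merging n \<sigma> ((u, v, w) # ms) \<sigma>'"
      by (rule merging.Cons[OF m q(2,4,6)]) (use k ms in auto)
    moreover have "rounds [(u, v, w)] 1" using rounds.append[OF rounds.Nil, of "[(u, v, w)]"] by simp
    then have "rounds ((u, v, w) # ms) (Suc k - 2)"
      using rounds_append[OF ms(2), of "[(u, v, w)]" 1] k by (simp add: Suc_diff_le)
    ultimately show ?thesis using ms(3) False by (metis min.absorb2 le_SucI not_le_imp_less less_imp_le)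
  qed
qed

lemma schedule_exists:
  assumes "after_rounds n \<sigma> 0"
  shows "\<exists>ms \<sigma>'. merging n \<sigma> ms \<sigma>' \<and> rounds ms (2 * J + (J - 2)) \<and>
    card {q. q < n \<and> (\<exists>i. \<sigma>' q = Value i)} \<le> 2"
proof -
  obtain ms \<tau> where ms: "merging n \<sigma> ms \<tau>" "rounds ms (2 * J)" "after_rounds n \<tau> (2 * J)"
    using rounds_exist[OF assms] by blast
  have V: "role_count n \<tau> (Value j) = (if 1 \<le> j \<and> j \<le> J then 1 else 0)" for j
  proof (cases "1 \<le> j \<and> j \<le> J")
    case True
    \<comment> \<open>After \<open>2 * J\<close> rounds level \<open>j\<close> has been halved at
      least \<open>Suc j\<close> times, enough for its size by \<open>upper\<close>.\<close>
    then have "Suc j \<le> Suc (2 * J) - j" by auto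
    then have "s j \<le> 1 * 2 ^ (Suc (2 * J) - j)"
      using upper[of j] True power_increasing[of "Suc j" "Suc (2 * J) - j" "2::nat"] by simp
    then have "halve (s j) (Suc (2 * J) - j) = 1"
      using halve_le_of_le halve_pos[OF pos] True by (metis le_antisym)
    then show ?thesis using ms(3) True by (simp add: after_rounds_def)
  next
    case False
    then show ?thesis using ms(3) zero[of j] by (auto simp: after_rounds_def)
  qed
  have "1 \<le> role_count n \<tau> (Clean j)" if "1 \<le> j" "j + 2 \<le> J" for j
  proof -
    have "role_count n \<tau> (Clean j) + 2 * role_count n \<tau> (Value j) + s (Suc j) =
        2 * s j + role_count n \<tau> (Value (Suc j))"
      using ms(3) that unfolding after_rounds_def by blast
    then have "role_count n \<tau> (Clean j) + 2 + s (Suc j) = 2 * s j + 1" using that by (simp add: V)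
    \<comment> \<open>With one value left on both levels, the slack in \<open>growth\<close> is what
      leaves a clean qubit of rank \<open>j\<close>.\<close>
    then show ?thesis using growth[of j] pos[of "Suc j"] that by auto
  qed
  then obtain ms' \<sigma>' where ms': "merging n \<tau> ms' \<sigma>'" "rounds ms' (J - 2)"
    "\<And>j. role_count n \<sigma>' (Value j) = (if 1 \<le> j \<and> j \<le> min J 2 then 1 else 0)"
    using ladder_exists[of n \<tau> J] V by blast
  have "{q. q < n \<and> (\<exists>i. \<sigma>' q = Value i)} \<subseteq>
      {q. q < n \<and> \<sigma>' q = Value 1} \<union> {q. q < n \<and> \<sigma>' q = Value 2}"
  proof
    fix q assume "q \<in> {q. q < n \<and> (\<exists>i. \<sigma>' q = Value i)}"
    then obtain i where q: "q < n" "\<sigma>' q = Value i" by blast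
    then have "role_count n \<sigma>' (Value i) \<noteq> 0"
      unfolding role_count_def by (subst card_0_eq) auto
    then have "i = 1 \<or> i = 2" using ms'(3)[of i] by (auto split: if_splits)
    then show "q \<in> {q. q < n \<and> \<sigma>' q = Value 1} \<union> {q. q < n \<and> \<sigma>' q = Value 2}"
      using q by auto
  qed
  then have "card {q. q < n \<and> (\<exists>i. \<sigma>' q = Value i)} \<le>
      card ({q. q < n \<and> \<sigma>' q = Value 1} \<union> {q. q < n \<and> \<sigma>' q = Value 2})"
    by (intro card_mono) auto
  also have "\<dots> \<le> role_count n \<sigma>' (Value 1) + role_count n \<sigma>' (Value 2)"
    unfolding role_count_def by (rule card_Un_le)
  finally have "card {q. q < n \<and> (\<exists>i. \<sigma>' q = Value i)} \<le>
      role_count n \<sigma>' (Value 1) + role_count n \<sigma>' (Value 2)" .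
  moreover have "role_count n \<sigma>' (Value 1) \<le> 1" "role_count n \<sigma>' (Value 2) \<le> 1"
    by (simp_all add: ms'(3))
  ultimately have "card {q. q < n \<and> (\<exists>i. \<sigma>' q = Value i)} \<le> 2" by linarith
  then show ?thesis
    using merging_append[OF ms(1) ms'(1)] rounds_append[OF ms'(2) ms(2)] by blast
qed

end

text \<open>The largest admissible sizes for \<open>growth\<close> are \<open>2 ^ (j - 1) + 2\<close>; level \<open>j\<close> is the block of
  qubits between \<open>level_end (j - 1)\<close> and \<open>level_end j\<close>, after the two initially clean qubits.\<close>

definition level_end :: "nat \<Rightarrow> nat" where
  "level_end j = 2 ^ j + 2 * j + 1"

definition initial_role :: "nat \<Rightarrow> role" where
  "initial_role q = (if q < 2 then Clean 0 else Value (LEAST j. q < level_end j))"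

definition level_size :: "nat \<Rightarrow> nat \<Rightarrow> nat" where
  "level_size n j = min n (level_end j) - level_end (j - 1)"

lemma level_end_0 [simp]: "level_end 0 = 2"
  by (simp add: level_end_def)

lemma level_end_Suc: "level_end (Suc j) = level_end j + 2 ^ j + 2"
  by (simp add: level_end_def)

lemma level_end_mono: "i \<le> j \<Longrightarrow> level_end i \<le> level_end j"
  by (simp add: level_end_def add_mono)

lemma initial_role_Value_iff:
  "initial_role q = Value j \<longleftrightarrow> 1 \<le> j \<and> level_end (j - 1) \<le> q \<and> q < level_end j"
proof (cases "q < 2")
  case True
  then show ?thesis using level_end_mono[of 0 "j - 1"] by (auto simp: initial_role_def)
next
  case False
  have ex: "q < level_end q" by (simp add: level_end_def)
  define l where "l = (LEAST j. q < level_end j)"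
  have l: "q < level_end l" unfolding l_def by (rule LeastI[of _ q]) (rule ex)
  have least: "level_end i \<le> q" if "i < l" for i
    using that not_less_Least[of i "\<lambda>j. q < level_end j"] by (simp add: l_def)
  have "l \<noteq> 0" using l False by (auto intro: ccontr)
  have "l = j \<longleftrightarrow> 1 \<le> j \<and> level_end (j - 1) \<le> q \<and> q < level_end j"
  proof
    assume "l = j"
    then show "1 \<le> j \<and> level_end (j - 1) \<le> q \<and> q < level_end j"
      using l least[of "j - 1"] \<open>l \<noteq> 0\<close> by auto
  next
    assume j: "1 \<le> j \<and> level_end (j - 1) \<le> q \<and> q < level_end j"
    have "\<not> l < j"
    proof
      assume "l < j"
      then have "level_end l \<le> level_end (j - 1)" by (intro level_end_mono) simp
      then show False using l j by linarith
    qed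
    moreover have "\<not> j < l" using least[of j] j by auto
    ultimately show "l = j" by simp
  qed
  then show ?thesis using False by (simp add: initial_role_def l_def)
qed

lemma role_count_initial_Value:
  "role_count n initial_role (Value j) = (if j = 0 then 0 else level_size n j)"
proof -
  have "{q. q < n \<and> initial_role q = Value j} =
      (if j = 0 then {} else {level_end (j - 1)..<min n (level_end j)})"
    by (auto simp: initial_role_Value_iff)
  then show ?thesis by (simp add: role_count_def level_size_def)
qed

lemma role_count_initial_Clean:
  assumes "2 \<le> n"
  shows "role_count n initial_role (Clean j) = (if j = 0 then 2 else 0)"
proof -
  have "{q. q < n \<and> initial_role q = Clean j} = (if j = 0 then {0..<2} else {})"
    using assms by (auto simp: initial_role_def split: if_splits)
  then show ?thesis by (simp add: role_count_def)
qed

lemma initial_values: "{q. q < n \<and> (\<exists>i. initial_role q = Value i)} = {2..<n}"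
  by (auto simp: initial_role_def)

lemma values_set_initial: "values_set n initial_role y \<longleftrightarrow> (\<forall>q<n. 2 \<le> q \<longrightarrow> y q)"
  by (auto simp: values_set_def initial_role_def)

text \<open>No value has rank 0, so soundness at rank 0 demands that the two \<open>Clean 0\<close>
  qubits hold 1 outright.\<close>

lemma clean_sound_initial: "y 0 \<Longrightarrow> y 1 \<Longrightarrow> clean_sound n initial_role y"
  by (auto simp: clean_sound_def initial_role_def less_2_cases_iff split: if_splits)

text \<open>\<open>J\<close> is the first level whose end reaches \<open>n\<close>. Minimality gives
  \<open>level_end (J - 1) < n\<close>, which bounds \<open>2 ^ J\<close> because level ends grow
  exponentially.\<close>

lemma merging_exists:
  assumes "3 \<le> n"
  shows "\<exists>J ms \<sigma>. 2 ^ J \<le> 2 * n \<and> merging n initial_role ms \<sigma> \<and> rounds ms (2 * J + (J - 2)) \<and>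
    card {q. q < n \<and> (\<exists>i. \<sigma> q = Value i)} \<le> 2"
proof -
  have ex: "n \<le> level_end n" by (simp add: level_end_def)
  define J where "J = (LEAST J. n \<le> level_end J)"
  have J: "n \<le> level_end J" unfolding J_def by (rule LeastI[of _ n]) (rule ex)
  have below: "level_end j < n" if "j < J" for j
    using that not_less_Least[of j "\<lambda>J. n \<le> level_end J"] by (simp add: J_def)
  have "J \<noteq> 0" using J assms by (auto intro: ccontr)
  then have "level_end (J - 1) < n" using below by simp
  moreover have "2 ^ J = 2 * (2 ^ (J - 1) :: nat)" using \<open>J \<noteq> 0\<close> by (cases J) auto
  ultimately have pow: "2 ^ J \<le> 2 * n" by (simp add: level_end_def)
  interpret level_sizes "level_size n" J
  proof
    show "level_size n 1 \<le> 3" by (simp add: level_size_def level_end_def)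
    show "level_size n (Suc j) = 0 \<or> level_size n (Suc j) + 2 \<le> 2 * level_size n j"
      if "1 \<le> j" for j
      \<comment> \<open>A nonempty level forces the one below it to be full; for two full levels the
        bound is an equality.\<close>
      using that by (cases j) (auto simp: level_size_def level_end_Suc min_def)
    show "1 \<le> level_size n j" if "1 \<le> j" "j \<le> J" for j
    proof -
      have "level_end (j - 1) < n" using that by (intro below) linarith
      then show ?thesis using that level_end_Suc[of "j - 1"] by (simp add: level_size_def)
    qed
    show "level_size n j = 0" if "J < j" for j
    proof -
      have "level_end J \<le> level_end (j - 1)" using that by (intro level_end_mono) linarith
      then show ?thesis using J by (simp add: level_size_def)
    qed
    show "level_size n j \<le> 2 ^ Suc j" if j: "1 \<le> j" for j
    proof -
      obtain i where i: "j = Suc i" using j by (cases j) auto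
      have "level_size n j \<le> 2 ^ i + 2" by (simp add: level_size_def i level_end_Suc)
      also have "\<dots> \<le> 2 ^ Suc j" using one_le_power[of "2::nat" i] unfolding i power_Suc by linarith
      finally show ?thesis .
    qed
  qed
  have "after_rounds n initial_role 0"
    unfolding after_rounds_def using assms
    by (auto simp: role_count_initial_Value role_count_initial_Clean)
  from schedule_exists[OF this] pow show ?thesis by blast
qed

subsection \<open>The circuit\<close>

lemma has_depth_parallel_merges:
  "parallel ms \<Longrightarrow> has_depth (merges_circuit ms) 8"
proof (induction ms)
  case Nil
  show ?case by (simp add: has_depth_length)
next
  case (Cons m ms)
  have qubits: "gate_qubits g \<subseteq> merge_qubits m" if "g \<in> set (merge_circuit m)" for g m
    using that by (cases m) auto
  have "has_depth (merge_circuit m) 8" by (cases m) (simp add: has_depth_length)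
  moreover have "gate_qubits g \<inter> gate_qubits h = {}"
    if g: "g \<in> set (merge_circuit m)" and h: "h \<in> set (merges_circuit ms)" for g h
  proof -
    obtain m' where "m' \<in> set ms" "h \<in> set (merge_circuit m')"
      using h by (auto simp: merges_circuit_def)
    moreover have "\<forall>m'\<in>set ms. merge_qubits m \<inter> merge_qubits m' = {}" using Cons.prems by simp
    ultimately show ?thesis using qubits g by blast
  qed
  ultimately have "has_depth (merge_circuit m @ merges_circuit ms) 8"
    using Cons by (intro has_depth_append_disjoint) simp_all
  then show ?case by simp
qed

lemma merges_circuit_append: "merges_circuit (a @ b) = merges_circuit a @ merges_circuit b"
  by (simp add: merges_circuit_def)

lemma has_depth_rounds: "rounds ms d \<Longrightarrow> has_depth (merges_circuit ms) (8 * d)"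
proof (induction rule: rounds.induct)
  case Nil
  show ?case by (simp add: has_depth_length)
next
  case (append ms d ms')
  then show ?case
    using has_depth_append[OF append.IH has_depth_parallel_merges[OF append.hyps(2)]]
    by (simp add: merges_circuit_append add.commute)
qed

text \<open>\<open>rot_z (pi / 2)\<close> is i times Pauli Z, and the rotation by pi/4 carries the Z
  axis to the X axis.\<close>

lemma rot_conjugation: "rot_y (pi / 4) * (rot_z (pi / 2) * rot_y (- (pi / 4))) = mat2 0 \<i> \<i> 0"
proof -
  have "complex_of_real (sqrt 2) * complex_of_real (sqrt 2) = 2"
    by (simp flip: of_real_mult)
  then show ?thesis
    by (simp add: rot_y_def rot_z_def sin_45 cos_45 cis_pi_half field_simps)
qed

text \<open>\<open>rot_y (pi / 2)\<close> is antidiagonal with entries of modulus 1, hence X up to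
  phases. As its cost is exponential in \<open>n\<close>, this circuit serves for small
  \<open>n\<close> only.\<close>

lemma relative_phase_toffoli_small:
  "relative_phase_toffoli n (circuit_mat (n + 1) (controlled_rotation rot_y n [0..<n] (pi / 2)))"
proof (rule relative_phase_toffoliI)
  let ?c = "controlled_rotation rot_y n [0..<n] (pi / 2)"
  have valid: "valid_circuit (n + 1) ?c"
    by (intro controlled_rotation_valid rotation_family_rot_y) auto
  show "circuit_mat (n + 1) ?c = multiplexed (n + 1) n (circuit_block ?c)"
    using valid by (intro circuit_mat_eq_multiplexed) (auto dest: controlled_rotation_targets)
  have block: "circuit_block ?c y = (if \<forall>k<n. y k then rot_y (pi / 2) else 1\<^sub>m 2)" for y
    by (subst circuit_block_controlled_rotation[where N = "n + 1"]) (auto simp: rotation_family_rot_y)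
  show "\<exists>a b. circuit_block ?c y = mat2 0 a b 0 \<and> cmod a = 1 \<and> cmod b = 1"
    if "\<forall>k<n. y k" for y
    using that by (simp add: block rot_y_def)
  show "\<exists>a b. circuit_block ?c y = mat2 a 0 0 b \<and> cmod a = 1 \<and> cmod b = 1"
    if "\<not> (\<forall>k<n. y k)" for y
    unfolding block if_not_P[OF that] one_mat_2 by simp
qed

definition toffoli_circuit :: "nat \<Rightarrow> (nat \<times> nat \<times> nat) list \<Rightarrow> nat list \<Rightarrow> circuit" where
  "toffoli_circuit n ms F = controlled_rotation rot_y n [0, 1] (- (pi / 4)) @
     (merges_circuit ms @ controlled_rotation rot_z n F (pi / 2) @ circuit_inverse (merges_circuit ms)) @
     controlled_rotation rot_y n [0, 1] (pi / 4)"

lemma valid_toffoli_circuit: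
  assumes "2 \<le> n" "\<forall>m\<in>set ms. merge_below n m" "\<forall>q\<in>set F. q < n"
  shows "valid_circuit (n + 1) (toffoli_circuit n ms F)"
proof -
  have "valid_circuit (n + 1) (merges_circuit ms)"
    using assms by (intro merges_circuit_valid) auto
  then show ?thesis
    using assms unfolding toffoli_circuit_def valid_circuit_append
    by (intro conjI controlled_rotation_valid rotation_family_rot_y rotation_family_rot_z
        valid_circuit_inverse) auto
qed

lemma relative_phase_toffoli_circuit:
  assumes n: "2 \<le> n" and ms: "merging n initial_role ms \<sigma>"
    and F: "set F = {q. q < n \<and> (\<exists>i. \<sigma> q = Value i)}"
  shows "relative_phase_toffoli n (circuit_mat (n + 1) (toffoli_circuit n ms F))"
proof -
  let ?N = "n + 1"
  let ?R = "\<lambda>\<theta>. controlled_rotation rot_y n [0, 1] \<theta>"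
  let ?Z = "controlled_rotation rot_z n F (pi / 2)"
  let ?W = "merges_circuit ms @ ?Z @ circuit_inverse (merges_circuit ms)"
  define A where "A \<theta> y = (if y 0 \<and> y 1 then rot_y \<theta> else 1\<^sub>m 2)" for \<theta> and y :: "nat \<Rightarrow> bool"
  define B where "B y = (if values_set n \<sigma> (merges_bits ms y) then rot_z (pi / 2) else 1\<^sub>m 2)" for y
  define K where "K y = A (pi / 4) y * (B y * A (- (pi / 4)) y)" for y
  have below: "\<forall>m\<in>set ms. merge_below n m" using merging_below[OF ms] by blast
  have carrier: "A \<theta> y \<in> carrier_mat 2 2" "B y \<in> carrier_mat 2 2" for \<theta> y
    by (simp_all add: A_def B_def rot_y_def rot_z_def)
  have R_valid: "valid_circuit ?N (?R \<theta>)" for \<theta>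
    using n by (intro controlled_rotation_valid rotation_family_rot_y) auto
  have R_block: "circuit_block (?R \<theta>) = A \<theta>" for \<theta>
    unfolding A_def using n
    by (intro ext, subst circuit_block_controlled_rotation[where N = ?N]) (auto simp: rotation_family_rot_y)
  have R: "circuit_mat ?N (?R \<theta>) = multiplexed ?N n (A \<theta>)" for \<theta>
    unfolding R_block[symmetric]
    by (rule circuit_mat_eq_multiplexed[OF _ R_valid]) (auto dest: controlled_rotation_targets)
  have A_indep: "independent_of n (A \<theta>)" for \<theta>
    unfolding R_block[symmetric]
    by (rule circuit_block_independent[OF R_valid]) (auto dest: controlled_rotation_targets)
  have Z_valid: "valid_circuit ?N ?Z"
    using F by (intro controlled_rotation_valid rotation_family_rot_z) auto
  have Z_indep: "independent_of n (circuit_block ?Z)"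
    by (rule circuit_block_independent[OF Z_valid]) (auto dest: controlled_rotation_targets)
  have "circuit_mat ?N ?W = multiplexed ?N n (\<lambda>y. circuit_block ?Z (merges_bits ms y))"
  proof (rule circuit_mat_conjugate_merges[OF below])
    show "circuit_mat ?N ?Z = multiplexed ?N n (circuit_block ?Z)"
      by (rule circuit_mat_eq_multiplexed[OF _ Z_valid]) (auto dest: controlled_rotation_targets)
  qed (use Z_indep in auto)
  moreover have Z_block: "circuit_block ?Z (merges_bits ms y) = B y" for y
    using F by (subst circuit_block_controlled_rotation[where N = ?N])
      (auto simp: rotation_family_rot_z B_def values_set_def)
  ultimately have W: "circuit_mat ?N ?W = multiplexed ?N n B" by simp
  have B_indep: "independent_of n B"
    using independent_of_merges[OF below Z_indep] by (simp add: Z_block)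
  have "circuit_mat ?N (toffoli_circuit n ms F) =
      multiplexed ?N n (A (pi / 4)) * (multiplexed ?N n B * multiplexed ?N n (A (- (pi / 4))))"
    unfolding toffoli_circuit_def circuit_mat_append[of _ "?R _"] circuit_mat_append[of _ ?W] R W
    by (simp add: circuit_mat_append R W
        assoc_mult_mat[OF multiplexed_carrier multiplexed_carrier multiplexed_carrier])
  also have "\<dots> = multiplexed ?N n K"
    using A_indep B_indep carrier unfolding K_def by (simp add: multiplexed_mult)
  finally have mat: "circuit_mat ?N (toffoli_circuit n ms F) = multiplexed ?N n K" .
  have clean: "values_set n \<sigma> (merges_bits ms y) \<longleftrightarrow> (\<forall>k<n. y k)" if "y 0" "y 1" for y
  proof -
    have "values_set n \<sigma> (merges_bits ms y) \<longleftrightarrow> (\<forall>q<n. 2 \<le> q \<longrightarrow> y q)"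
      using merging_sound[OF ms clean_sound_initial[OF that]] by (simp add: values_set_initial)
    then show ?thesis using that by (metis One_nat_def less_2_cases not_le_imp_less)
  qed
  have "K y = mat2 0 \<i> \<i> 0" if "\<forall>k<n. y k" for y
    using that n clean[of y] by (simp add: K_def A_def B_def rot_conjugation)
  moreover have "\<exists>a b. K y = mat2 a 0 0 b \<and> cmod a = 1 \<and> cmod b = 1" if "\<not> (\<forall>k<n. y k)" for y
  proof (cases "y 0 \<and> y 1")
    case True
    then have "B y = 1\<^sub>m 2" using that clean[of y] by (auto simp: B_def)
    then have "K y = rot_y (pi / 4) * rot_y (- (pi / 4))"
      using True rotation_family_carrier[OF rotation_family_rot_y]
      by (simp add: K_def A_def mult_one_2)
    also have "\<dots> = mat2 1 0 0 1"
      using rotation_family_rot_y unfolding rotation_family_def one_mat_2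
      by (metis add.right_inverse)
    finally show ?thesis by auto
  next
    case False
    \<comment> \<open>The outer rotations are trivial here, and \<open>B y\<close> is diagonal
      whatever the merges compute.\<close>
    then have "K y = B y" using carrier(2) by (auto simp: K_def A_def mult_one_2)
    then show ?thesis by (auto simp: B_def rot_z_def one_mat_2)
  qed
  ultimately show ?thesis by (intro relative_phase_toffoliI[OF mat]) simp_all
qed

text \<open>The outer rotations cost 6 each. A merge costs 3 and occurs twice, and the inner
  rotation costs at most 6 per qubit of \<open>F\<close>, so the total is at most
  \<open>12 + 6 * (n - 2) = 6 * n\<close>.\<close>

lemma cnot_count_toffoli_circuit:
  assumes "2 \<le> n" "length F \<le> 2" "length F + length ms = n - 2"
  shows "cnot_count (toffoli_circuit n ms F) \<le> 6 * n + 4"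
proof -
  have "cnot_count (controlled_rotation rot_y n [0, 1] \<theta>) = 6" for \<theta>
    using cnot_count_controlled_rotation[of rot_y n "[0, 1]" \<theta>] by simp
  moreover have "cnot_count (controlled_rotation rot_z n F (pi / 2)) \<le> 6 * length F"
    using cnot_count_controlled_rotation[of rot_z n F "pi / 2"] assms(2)
    by (auto simp: le_Suc_eq numeral_2_eq_2)
  ultimately show ?thesis
    using assms unfolding toffoli_circuit_def cnot_count_append cnot_count_inverse cnot_count_merges
    by simp
qed

lemma depth_toffoli_circuit:
  assumes "rounds ms d" "length F \<le> 2"
  shows "depth (toffoli_circuit n ms F) \<le> 30 + 16 * d"
proof -
  have "has_depth (controlled_rotation rot_y n [0, 1] \<theta>) 10" for \<theta>
    using length_controlled_rotation[of rot_y n "[0, 1]" \<theta>] by (intro has_depth_length) simp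
  moreover have "has_depth (controlled_rotation rot_z n F (pi / 2)) 10"
    using length_controlled_rotation[of rot_z n F "pi / 2"] power_increasing[OF assms(2), of "2::nat"]
    by (intro has_depth_length) simp
  ultimately have "has_depth (toffoli_circuit n ms F) (10 + (8 * d + (10 + 8 * d)) + 10)"
    unfolding toffoli_circuit_def
    using has_depth_rounds[OF assms(1)] has_depth_inverse[OF has_depth_rounds[OF assms(1)]]
    by (metis has_depth_append append.assoc)
  then show ?thesis using depth_le_of_has_depth by fastforce
qed

theorem theorem1:
  shows "\<exists>C::real. \<forall>n::nat. n \<ge> 1 \<longrightarrow>
    (\<exists>c::circuit. valid_circuit (n + 1) c
       \<and> relative_phase_toffoli n (circuit_mat (n + 1) c)
       \<and> cnot_count c \<le> 6 * n + 4
       \<and> real (depth c) \<le> C * (1 + log 2 (real n)))"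
\<comment> \<open>78 is 30 + 16 * 3: the schedule has at most \<open>3 * J\<close> rounds, each of
  depth 8 and run twice, and \<open>J\<close> is at most \<open>1 + l\<close>.\<close>
proof (intro exI[of _ 78] allI impI)
  fix n :: nat assume n: "1 \<le> n"
  define l where "l = log 2 (real n)"
  have l: "0 \<le> l" using n by (simp add: l_def)
  show "\<exists>c. valid_circuit (n + 1) c \<and> relative_phase_toffoli n (circuit_mat (n + 1) c) \<and>
    cnot_count c \<le> 6 * n + 4 \<and> real (depth c) \<le> 78 * (1 + log 2 (real n))"
  \<comment> \<open>With at most two controls the multiplexed rotation alone has at most 10
    gates.\<close>
  proof (cases "n < 3")
    case True
    let ?c = "controlled_rotation rot_y n [0..<n] (pi / 2)"
    have "(2::nat) ^ n \<le> 2 ^ 2" using True by (intro power_increasing) auto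
    then have "length ?c \<le> 10" "cnot_count ?c \<le> 6"
      using length_controlled_rotation[of rot_y n "[0..<n]" "pi / 2"]
        cnot_count_controlled_rotation[of rot_y n "[0..<n]" "pi / 2"] by auto
    moreover from this have "depth ?c \<le> 10" by (intro depth_le_of_has_depth has_depth_length)
    then have "real (depth ?c) \<le> 10" by simp
    then have "real (depth ?c) \<le> 78 * (1 + log 2 (real n))"
      by (rule order_trans) (use l in \<open>simp add: l_def\<close>)
    moreover have "valid_circuit (n + 1) ?c"
      by (intro controlled_rotation_valid rotation_family_rot_y) auto
    ultimately show ?thesis
      using relative_phase_toffoli_small[of n] n by (intro exI[of _ ?c]) auto
  next
    case False
    then obtain J ms \<sigma> where J: "2 ^ J \<le> 2 * n" and ms: "merging n initial_role ms \<sigma>"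
      "rounds ms (2 * J + (J - 2))" and card: "card {q. q < n \<and> (\<exists>i. \<sigma> q = Value i)} \<le> 2"
      using merging_exists[of n] by auto
    define F where "F = sorted_list_of_set {q. q < n \<and> (\<exists>i. \<sigma> q = Value i)}"
    have F: "set F = {q. q < n \<and> (\<exists>i. \<sigma> q = Value i)}"
      "length F = card {q. q < n \<and> (\<exists>i. \<sigma> q = Value i)}" by (simp_all add: F_def)
    let ?c = "toffoli_circuit n ms F"
    have "length F + length ms = n - 2"
      using merging_card_values[OF ms(1)] by (simp add: F initial_values)
    then have "cnot_count ?c \<le> 6 * n + 4"
      using False card F by (intro cnot_count_toffoli_circuit) auto
    moreover have "valid_circuit (n + 1) ?c"
      using False F merging_below[OF ms(1)] by (intro valid_toffoli_circuit) auto
    moreover have "relative_phase_toffoli n (circuit_mat (n + 1) ?c)"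
      using False ms F by (intro relative_phase_toffoli_circuit) auto
    moreover have "real (depth ?c) \<le> 78 * (1 + log 2 (real n))"
    proof -
      have "real J \<le> log 2 (real (2 * n))" using J by (rule le_log2_of_power)
      also have "\<dots> = 1 + l" using n by (simp add: log_mult l_def)
      finally have J': "real J \<le> 1 + l" .
      have "depth ?c \<le> 30 + 48 * J"
        using depth_toffoli_circuit[OF ms(2), of F n] card F by simp
      then have "real (depth ?c) \<le> real (30 + 48 * J)" by (rule of_nat_mono)
      also have "\<dots> \<le> 78 * (1 + log 2 (real n))"
        using l J' unfolding l_def[symmetric] by simp
      finally show ?thesis .
    qed
    ultimately show ?thesis by blast
  qed
qed

end
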